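(* For any real numbers $C,\delta>0$ there exists some $c>0$ such that there exist infinitely many connected graphs $G$ with maximum degree $6$ for which, writing $n$ for the number of vertices of $G$, the spectral gap of $G$ is at least $C/\log n$ and $$m_G\left[\left(1-\frac{\delta}{\log n}\right)\lambda_2(G),\ \lambda_2(G)\right]\ \ge\ \frac{c\,n}{\log\log n}.$$
   Context: All graphs are finite and undirected. Eigenvalues of a graph $G$ always refer to its adjacency matrix and are listed in descending order with multiplicity as $\lambda_1(G)\ge\lambda_2(G)\ge\cdots\ge\lambda_{|V(G)|}(G)$. The spectral gap of $G$ is $\lambda_1(G)-\lambda_2(G)$ (not normalized by the degree). For real $a\le b$, $m_G[a,b]:=\#\{j:\lambda_j(G)\in[a,b]\}$ is the number of eigenvalues of $G$, counted with multiplicity, lying in $[a,b]$. *)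

theory Defs
  imports
    "Jordan_Normal_Form.Char_Poly"
    "Graph_Theory.Graph_Theory"
begin

text \<open>
  Graphs are finite simple undirected graphs: the library's locale \<^term>\<open>pair_graph\<close>, where an
  undirected edge \<open>uv\<close> is the pair of arcs \<open>(u,v)\<close>, \<open>(v,u)\<close>.

  A standard graph has vertex set \<open>{0..<n}\<close>. Every finite graph is isomorphic to a standard one, and
  there are only finitely many standard graphs of each order, so a set of standard graphs is infinite
  iff it contains infinitely many graphs up to isomorphism. Without this normalisation, renaming
  the vertices of one graph would already give infinitely many.
\<close>

abbreviation order_graph :: "nat pair_pre_digraph \<Rightarrow> nat" where
  "order_graph G \<equiv> card (pverts G)"

definition standard_graph :: "nat pair_pre_digraph \<Rightarrow> bool" where
  "standard_graph G \<longleftrightarrow> pair_graph G \<and> pverts G = {0..<order_graph G}"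

text \<open>By symmetry of the arc relation, the out-degree of a vertex is its number of neighbours.\<close>

definition max_degree :: "nat pair_pre_digraph \<Rightarrow> nat" where
  "max_degree G = Max (out_degree (with_proj G) ` pverts G)"

definition adj_matrix :: "nat pair_pre_digraph \<Rightarrow> real mat" where
  "adj_matrix G = mat (order_graph G) (order_graph G) (\<lambda>(i, j). if (i, j) \<in> parcs G then 1 else 0)"

text \<open>
  The real roots of the characteristic polynomial, with multiplicity, in descending order. For a
  standard graph the matrix is symmetric, so these are all \<open>n\<close> eigenvalues; see
  \<open>length_eigenvalues\<close> below.
\<close>

definition eigenvalues :: "nat pair_pre_digraph \<Rightarrow> real list" where
  "eigenvalues G = rev (sorted_list_of_multiset (proots (char_poly (adj_matrix G))))"

text \<open>Numbered from 1; meaningful for \<open>1 \<le> j \<le> n\<close>.\<close>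

definition eig :: "nat pair_pre_digraph \<Rightarrow> nat \<Rightarrow> real" where
  "eig G j = eigenvalues G ! (j - 1)"

definition spectral_gap :: "nat pair_pre_digraph \<Rightarrow> real" where
  "spectral_gap G = eig G 1 - eig G 2"

definition eig_count :: "nat pair_pre_digraph \<Rightarrow> real \<Rightarrow> real \<Rightarrow> nat" where
  "eig_count G a b = card {j \<in> {1..order_graph G}. eig G j \<in> {a..b}}"

lemma symmetric_real_eigenvalue:
  fixes A :: "real mat"
  assumes A: "A \<in> carrier_mat n n"
    and sym: "\<And>i j. i < n \<Longrightarrow> j < n \<Longrightarrow> A $$ (i, j) = A $$ (j, i)"
    and ev: "eigenvalue (map_mat complex_of_real A) a"
  shows "a \<in> \<real>"
proof -
  let ?B = "map_mat complex_of_real A"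
  from ev A obtain v where v: "v \<in> carrier_vec n" "v \<noteq> 0\<^sub>v n" "?B *\<^sub>v v = a \<cdot>\<^sub>v v"
    unfolding eigenvalue_def eigenvector_def by auto
  define S where "S = (\<Sum>i<n. \<Sum>j<n. of_real (A $$ (i, j)) * v $ j * cnj (v $ i))"
  define T where "T = (\<Sum>i<n. (cmod (v $ i))\<^sup>2)"
  have row: "(\<Sum>j<n. of_real (A $$ (i, j)) * v $ j) = a * v $ i" if "i < n" for i
  proof -
    have "(?B *\<^sub>v v) $ i = (a \<cdot>\<^sub>v v) $ i"
      using v(3) by simp
    thus ?thesis
      using that A v(1) by (auto simp: scalar_prod_def atLeast0LessThan)
  qed
  have "S = (\<Sum>i<n. (\<Sum>j<n. of_real (A $$ (i, j)) * v $ j) * cnj (v $ i))"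
    by (simp add: S_def sum_distrib_right)
  also have "\<dots> = (\<Sum>i<n. a * of_real ((cmod (v $ i))\<^sup>2))"
    by (intro sum.cong refl) (simp add: row complex_norm_square mult.assoc del: of_real_power)
  finally have ST: "S = a * of_real T"
    by (simp add: T_def sum_distrib_left)
  have "cnj S = (\<Sum>i<n. \<Sum>j<n. of_real (A $$ (i, j)) * cnj (v $ j) * v $ i)"
    by (simp add: S_def)
  also have "\<dots> = (\<Sum>j<n. \<Sum>i<n. of_real (A $$ (i, j)) * cnj (v $ j) * v $ i)"
    by (rule sum.swap)
  also have "\<dots> = S"
    unfolding S_def by (intro sum.cong refl) (simp add: sym mult_ac)
  finally have S: "S \<in> \<real>"
    by (simp add: Reals_cnj_iff)
  obtain i where i: "i < n" "v $ i \<noteq> 0"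
    using v(1,2) by (metis carrier_vecD eq_vecI index_zero_vec)
  have "T > 0"
    unfolding T_def by (rule sum_pos2[of _ i]) (use i in auto)
  hence "a = S / of_real T"
    using ST by simp
  thus ?thesis
    using S by simp
qed

lemma length_eigenvalues:
  assumes "standard_graph G"
  shows "length (eigenvalues G) = order_graph G"
proof -
  define n where "n = order_graph G"
  define A where "A = adj_matrix G"
  interpret pair_graph G
    using assms by (simp add: standard_graph_def)
  interpret hom: map_poly_comm_semiring_hom complex_of_real ..
  have A: "A \<in> carrier_mat n n"
    by (simp add: A_def adj_matrix_def n_def)
  have "sym (parcs G)"
    using pair_sym_arcs by (simp add: symmetric_def)
  hence sym: "A $$ (i, j) = A $$ (j, i)" if "i < n" "j < n" for i j
    using that by (auto simp: A_def adj_matrix_def n_def dest: symD)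
  let ?B = "map_mat complex_of_real A"
  have B: "?B \<in> carrier_mat n n"
    using A by simp
  obtain as where as: "char_poly ?B = (\<Prod>a\<leftarrow>as. [:- a, 1:])" "length as = n"
    using char_poly_factorized[OF B] by blast
  have re: "complex_of_real (Re a) = a" if "a \<in> set as" for a
  proof -
    have "poly (char_poly ?B) a = 0"
      unfolding as(1) using that by (induction as) auto
    hence "eigenvalue ?B a"
      using eigenvalue_root_char_poly[OF B] by simp
    thus ?thesis
      using symmetric_real_eigenvalue[OF A sym] by (simp add: of_real_Re)
  qed
  have "map_poly complex_of_real (char_poly A) = char_poly ?B"
    by (simp add: of_real_hom.char_poly_hom[OF A])
  also have "\<dots> = map_poly complex_of_real (\<Prod>a\<leftarrow>as. [:- Re a, 1:])"
    unfolding as(1) using re by (induction as) (auto simp: hom.hom_mult simp del: mult_pCons_left)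
  finally have "char_poly A = (\<Prod>a\<leftarrow>as. [:- Re a, 1:])"
    by (simp add: poly_eq_iff coeff_map_poly)
  moreover have "proots (\<Prod>a\<leftarrow>rs. [:- a, 1:]) = mset rs" for rs :: "real list"
  proof (induction rs)
    case (Cons r rs)
    have "(\<Prod>a\<leftarrow>rs. [:- a, 1:]) \<noteq> 0"
      by (auto simp: prod_list_zero_iff)
    thus ?case
      using Cons by (simp add: proots_mult del: mult_pCons_left)
  qed simp
  from this[of "map Re as"] have "proots (\<Prod>a\<leftarrow>as. [:- Re a, 1:]) = mset (map Re as)"
    by (simp add: o_def)
  ultimately have "size (proots (char_poly A)) = n"
    using as(2) by simp
  thus ?thesis
    by (metis A_def eigenvalues_def length_rev mset_sorted_list_of_multiset n_def size_mset)
qed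

end

theory Submission
  imports Defs "Jordan_Normal_Form.Schur_Decomposition" "HOL-Real_Asymp.Real_Asymp"
begin

text \<open>
  The graph consists of a long path carrying a 6-clique at its start and a triangle in the middle
  of each later block. The clique alone forces \<open>\<lambda>\<^sub>1 \<ge> 5\<close>, while on the hyperplane of vectors with
  sum zero on the clique the quadratic form is at most that of the triangulated path. A triangle
  with two infinite tails has top eigenvalue \<open>\<theta> = r + 1/r\<close>, where \<open>r\<^sup>3 = r\<^sup>2 + r + 1\<close>, with an
  eigenvector decaying like \<open>r\<^sup>-\<^sup>d\<close>. Hence triangles at distance about \<open>2T\<close> shift eigenvalues by
  only \<open>\<epsilon> = O(r\<^sup>-\<^sup>2\<^sup>T)\<close>: \<open>\<lambda>\<^sub>2 \<le> \<theta> + \<epsilon>\<close>, and one test vector per triangle gives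
  \<open>\<lambda>\<^sub>j \<ge> \<theta> - \<epsilon>\<close> for as many \<open>j\<close> as there are triangles. With \<open>2^(2^T)\<close> blocks, \<open>ln n\<close> is of order
  \<open>2\<^sup>T\<close>, which is negligible against \<open>1/\<epsilon>\<close>, and the block length is of order \<open>ln (ln n)\<close>.
\<close>

section \<open>Spectral theorem and min-max bounds\<close>

text \<open>Linear factors split off one by one until the cofactor has no root. Comparing degrees
  and leading coefficients then forces the cofactor to be 1.\<close>

lemma split_poly_of_size_proots:
  fixes p :: "'a::field poly"
  assumes "monic p" and "size (proots p) = degree p"
  shows "p = (\<Prod>a\<in>#proots p. [:- a, 1:])"
proof -
  have "\<exists>q. p = (\<Prod>a\<in>#proots p. [:- a, 1:]) * q" if "p \<noteq> 0" for p :: "'a poly"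
    using that
  proof (induction "degree p" arbitrary: p rule: less_induct)
    case less
    show ?case
    proof (cases "\<exists>a. poly p a = 0")
      case True
      then obtain a q where q: "p = [:- a, 1:] * q"
        by (auto simp: poly_eq_0_iff_dvd elim: dvdE)
      with less.prems have "q \<noteq> 0" by auto
      hence "degree q < degree p"
        unfolding q by (subst degree_mult_eq) auto
      from less.hyps[OF this \<open>q \<noteq> 0\<close>] obtain s where
        s: "q = (\<Prod>a\<in>#proots q. [:- a, 1:]) * s" ..
      have "proots p = add_mset a (proots q)"
        unfolding q using \<open>q \<noteq> 0\<close> by (subst proots_mult) auto
      thus ?thesis
        using q s by (intro exI[of _ s]) (metis image_mset_add_mset mult.assoc prod_mset.add_mset)
    next
      case False
      hence "set_mset (proots p) = {}"
        using less.prems by auto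
      thus ?thesis by auto
    qed
  qed
  moreover have "p \<noteq> 0" using assms(1) by auto
  ultimately obtain q where q: "p = (\<Prod>a\<in>#proots p. [:- a, 1:]) * q" by blast
  have nz: "(\<Prod>a\<in>#M. [:- a, 1:]) \<noteq> 0" for M :: "'a multiset"
    by (auto simp: prod_mset_zero_iff)
  have deg: "degree (\<Prod>a\<in>#M. [:- a, 1:]) = size M" for M :: "'a multiset"
  proof (induction M)
    case (add x M)
    thus ?case
      unfolding image_mset_add_mset prod_mset.add_mset by (subst degree_mult_eq) (use nz in auto)
  qed simp
  have mon: "monic (\<Prod>a\<in>#M. [:- a, 1:])" for M :: "'a multiset"
    by (induction M) (auto simp: lead_coeff_mult simp del: mult_pCons_left)
  have "q \<noteq> 0" using q \<open>p \<noteq> 0\<close> by auto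
  have "(\<Prod>a\<in>#proots p. [:- a, 1:]) \<noteq> 0" using q \<open>p \<noteq> 0\<close> by auto
  from degree_mult_eq[OF this \<open>q \<noteq> 0\<close>] have "degree q = 0"
    using q deg assms(2) by simp
  moreover have "lead_coeff q = 1"
    using assms(1) q mon by (metis lead_coeff_mult mult_1)
  ultimately have "q = 1"
    by (metis monic_degree_0)
  with q show ?thesis by simp
qed

lemma char_poly_eigenvalues:
  assumes "standard_graph G"
  shows "char_poly (adj_matrix G) = (\<Prod>a\<leftarrow>eigenvalues G. [:- a, 1:])"
proof -
  let ?p = "char_poly (adj_matrix G)"
  have "adj_matrix G \<in> carrier_mat (order_graph G) (order_graph G)"
    by (simp add: adj_matrix_def)
  from degree_monic_char_poly[OF this] have p: "degree ?p = order_graph G" "monic ?p" by auto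
  have m: "mset (eigenvalues G) = proots ?p"
    by (simp add: eigenvalues_def)
  hence "size (proots ?p) = degree ?p"
    using length_eigenvalues[OF assms] p(1) by (metis size_mset)
  from split_poly_of_size_proots[OF p(2) this]
  have "?p = (\<Prod>a\<in>#mset (eigenvalues G). [:- a, 1:])"
    by (simp add: m)
  thus ?thesis
    by (metis mset_map prod_mset_prod_list)
qed

lemma eigenvalues_antimono:
  assumes "standard_graph G" and "i \<le> j" and "j < order_graph G"
  shows "eigenvalues G ! j \<le> eigenvalues G ! i"
proof -
  have "sorted_wrt (\<ge>) (eigenvalues G)"
    unfolding eigenvalues_def
    by (metis (no_types, lifting) sorted_sorted_list_of_multiset sorted_wrt_rev sorted_wrt_mono_rel)
  thus ?thesis
    using assms length_eigenvalues[OF assms(1)] by (cases "i = j") (auto simp: sorted_wrt_iff_nth_less)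
qed

text \<open>Fewer equations than unknowns: the coefficients are placed in a square matrix with a
  zero row, which is singular. Both min-max bounds use this to find a vector in an intersection of
  subspaces.\<close>

lemma homogeneous_system_solution:
  fixes M :: "nat \<Rightarrow> nat \<Rightarrow> real"
  assumes "m < n"
  shows "\<exists>c. (\<exists>j<n. c j \<noteq> 0) \<and> (\<forall>i<m. (\<Sum>j<n. M i j * c j) = 0)"
proof -
  define A where "A = mat\<^sub>r n n (\<lambda>i. if i = m then 0\<^sub>v n else vec n (M i))"
  have A: "A \<in> carrier_mat n n" by (simp add: A_def)
  have "det A = 0"
    unfolding A_def using assms by (intro det_row_0) auto
  then obtain v where v: "v \<in> carrier_vec n" "v \<noteq> 0\<^sub>v n" "A *\<^sub>v v = 0\<^sub>v n"
    using det_0_iff_vec_prod_zero[OF A] by auto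
  have "(\<Sum>j<n. M i j * v $ j) = 0" if "i < m" for i
  proof -
    have "(A *\<^sub>v v) $ i = 0" using v(3) that assms by simp
    thus ?thesis
      using that assms v(1) by (simp add: A_def scalar_prod_def atLeast0LessThan)
  qed
  moreover have "\<exists>j<n. v $ j \<noteq> 0"
    using v(1,2) by (metis carrier_vecD eq_vecI index_zero_vec)
  ultimately show ?thesis by blast
qed

text \<open>
  Gram--Schmidt applied to a triangularising basis: since the operator is symmetric, the
  orthogonalised basis diagonalises it.
\<close>

lemma symmetric_triangular_orthonormal_eigenvectors:
  fixes a :: "nat \<Rightarrow> nat \<Rightarrow> real"
  assumes sym: "\<And>x y. x < n \<Longrightarrow> y < n \<Longrightarrow> a x y = a y x"
    and tri: "\<And>j x. j < n \<Longrightarrow> x < n \<Longrightarrow>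
      (\<Sum>y<n. a x y * v j y) = ev j * v j x + (\<Sum>i<j. b i j * v i x)"
    and dual: "\<And>i j. i < n \<Longrightarrow> j < n \<Longrightarrow> (\<Sum>x<n. q i x * v j x) = (if i = j then 1 else 0)"
    and "m \<le> n"
  shows "\<exists>u. (\<forall>i<m. \<forall>x<n. (\<Sum>y<n. a x y * u i y) = ev i * u i x) \<and>
    (\<forall>i<m. \<forall>j<m. (\<Sum>x<n. u i x * u j x) = (if i = j then 1 else 0)) \<and>
    (\<forall>i<m. \<exists>d. \<forall>x<n. u i x = (\<Sum>j<m. d j * v j x)) \<and>
    (\<forall>j<m. \<exists>d. \<forall>x<n. v j x = (\<Sum>i<m. d i * u i x))"
  using \<open>m \<le> n\<close>
proof (induction m)
  case (Suc m)
  hence mn: "m < n" by simp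
  define ip :: "(nat \<Rightarrow> real) \<Rightarrow> (nat \<Rightarrow> real) \<Rightarrow> real" where "ip f g = (\<Sum>x<n. f x * g x)" for f g
  from Suc obtain u where
    eu: "\<And>i x. i < m \<Longrightarrow> x < n \<Longrightarrow> (\<Sum>y<n. a x y * u i y) = ev i * u i x" and
    ou: "\<And>i j. i < m \<Longrightarrow> j < m \<Longrightarrow> ip (u i) (u j) = (if i = j then 1 else 0)" and
    uv: "\<forall>i<m. \<exists>d. \<forall>x<n. u i x = (\<Sum>j<m. d j * v j x)" and
    vu: "\<forall>j<m. \<exists>d. \<forall>x<n. v j x = (\<Sum>i<m. d i * u i x)"
    unfolding ip_def by fastforce
  obtain D where D: "\<And>i x. i < m \<Longrightarrow> x < n \<Longrightarrow> u i x = (\<Sum>j<m. D i j * v j x)"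
    using uv by metis
  obtain E where E: "\<And>j x. j < m \<Longrightarrow> x < n \<Longrightarrow> v j x = (\<Sum>i<m. E j i * u i x)"
    using vu by metis
  \<comment> \<open>One Gram-Schmidt step: \<open>w\<close> is \<open>v m\<close> minus its
    projection onto the \<open>u i\<close> already found.\<close>
  define c where "c i = ip (v m) (u i)" for i
  define w where "w x = v m x - (\<Sum>i<m. c i * u i x)" for x
  have ip_lin: "ip (\<lambda>x. \<Sum>i<m. d i * u i x) (u j) = d j" if "j < m" for d j
  proof -
    have "ip (\<lambda>x. \<Sum>i<m. d i * u i x) (u j) = (\<Sum>x<n. \<Sum>i<m. d i * (u i x * u j x))"
      by (simp add: ip_def sum_distrib_right mult.assoc)
    also have "\<dots> = (\<Sum>i<m. d i * ip (u i) (u j))"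
      by (subst sum.swap) (simp add: ip_def sum_distrib_left)
    also have "\<dots> = d j"
      using that by (simp add: ou if_distrib[of "(*) _"] cong: if_cong)
    finally show ?thesis .
  qed
  have ow: "ip w (u j) = 0" if "j < m" for j
  proof -
    have "ip w (u j) = ip (v m) (u j) - ip (\<lambda>x. \<Sum>i<m. c i * u i x) (u j)"
      by (simp add: w_def ip_def left_diff_distrib sum_subtractf)
    thus ?thesis using that by (simp add: ip_lin c_def)
  qed
  \<comment> \<open>By triangularity \<open>a\<close> maps \<open>w\<close> to
    \<open>ev m * w\<close> plus a combination of the \<open>u i\<close>. The \<open>e i\<close> are
    the coefficients of that combination.\<close>
  define e where "e i = ev m * c i + (\<Sum>j<m. b j m * E j i) - c i * ev i" for i
  have aw: "(\<Sum>y<n. a x y * w y) = ev m * w x + (\<Sum>i<m. e i * u i x)" if x: "x < n" for x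
  proof -
    have "(\<Sum>y<n. a x y * w y) = (\<Sum>y<n. a x y * v m y) - (\<Sum>y<n. \<Sum>i<m. c i * (a x y * u i y))"
      by (simp add: w_def right_diff_distrib sum_subtractf sum_distrib_left mult_ac)
    also have "(\<Sum>y<n. \<Sum>i<m. c i * (a x y * u i y)) = (\<Sum>i<m. c i * ev i * u i x)"
      by (subst sum.swap) (simp add: sum_distrib_left[symmetric] eu x mult_ac)
    also have "(\<Sum>y<n. a x y * v m y) = ev m * v m x + (\<Sum>j<m. b j m * v j x)"
      by (rule tri[OF mn x])
    also have "(\<Sum>j<m. b j m * v j x) = (\<Sum>j<m. \<Sum>i<m. b j m * E j i * u i x)"
      by (intro sum.cong refl) (simp add: E x sum_distrib_left mult_ac)
    also have "\<dots> = (\<Sum>i<m. (\<Sum>j<m. b j m * E j i) * u i x)"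
      by (subst sum.swap) (simp add: sum_distrib_right)
    also have "v m x = w x + (\<Sum>i<m. c i * u i x)"
      by (simp add: w_def)
    finally show ?thesis
      by (simp add: e_def algebra_simps sum.distrib sum_subtractf sum_distrib_left)
  qed
  \<comment> \<open>Symmetry moves \<open>a\<close> onto the eigenvector \<open>u j\<close>, which
    is orthogonal to \<open>w\<close>; so the image of \<open>w\<close> is also orthogonal to
    \<open>u j\<close>, and \<open>w\<close> is itself an eigenvector.\<close>
  have "e j = 0" if j: "j < m" for j
  proof -
    have "ip (\<lambda>x. \<Sum>y<n. a x y * w y) (u j) = (\<Sum>x<n. \<Sum>y<n. w y * (a y x * u j x))"
      unfolding ip_def sum_distrib_right
      by (intro sum.cong refl) (simp add: sym mult_ac)
    also have "\<dots> = ip w (\<lambda>x. ev j * u j x)"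
      unfolding ip_def
      by (subst sum.swap) (simp add: sum_distrib_left[symmetric] eu j)
    also have "\<dots> = ev j * ip w (u j)"
      by (simp add: ip_def sum_distrib_left mult_ac)
    finally have "ip (\<lambda>x. \<Sum>y<n. a x y * w y) (u j) = 0"
      using ow j by simp
    moreover have "ip (\<lambda>x. \<Sum>y<n. a x y * w y) (u j) =
        ip (\<lambda>x. ev m * w x + (\<Sum>i<m. e i * u i x)) (u j)"
      unfolding ip_def by (intro sum.cong refl) (simp add: aw)
    moreover have "\<dots> = ev m * ip w (u j) + ip (\<lambda>x. \<Sum>i<m. e i * u i x) (u j)"
      by (simp add: ip_def distrib_right sum.distrib sum_distrib_left mult.assoc)
    ultimately show ?thesis
      using ow ip_lin j by simp
  qed
  hence ew: "(\<Sum>y<n. a x y * w y) = ev m * w x" if "x < n" for x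
    using aw[OF that] by simp
  \<comment> \<open>Otherwise \<open>v m\<close> would lie in the span of the earlier
    \<open>v j\<close>, all of which the functional \<open>q m\<close> annihilates, although it
    takes the value 1 on \<open>v m\<close>.\<close>
  have "\<exists>x<n. w x \<noteq> 0"
  proof (rule ccontr)
    assume "\<not> ?thesis"
    hence "v m x = (\<Sum>i<m. c i * u i x)" if "x < n" for x
      using that by (auto simp: w_def)
    hence vm: "v m x = (\<Sum>j<m. (\<Sum>i<m. c i * D i j) * v j x)" if "x < n" for x
      using that
      by (simp add: D sum_distrib_left sum_distrib_right mult_ac) (rule sum.swap)
    have "1 = (\<Sum>x<n. q m x * v m x)"
      using dual[OF mn mn] by simp
    also have "\<dots> = (\<Sum>x<n. \<Sum>j<m. (\<Sum>i<m. c i * D i j) * (q m x * v j x))"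
      by (intro sum.cong refl) (subst vm, auto simp: sum_distrib_left mult_ac)
    also have "\<dots> = (\<Sum>j<m. (\<Sum>i<m. c i * D i j) * (\<Sum>x<n. q m x * v j x))"
      by (subst sum.swap) (simp add: sum_distrib_left)
    also have "\<dots> = 0"
      using mn by (intro sum.neutral) (auto simp: dual)
    finally show False by simp
  qed
  then obtain x0 where "x0 < n" "w x0 \<noteq> 0" by blast
  hence N: "ip w w > 0"
    unfolding ip_def by (intro sum_pos2[of _ x0]) (auto simp: zero_less_mult_iff)
  define s where "s = sqrt (ip w w)"
  have s: "s > 0" "s * s = ip w w" using N by (auto simp: s_def)
  define u' where "u' i = (if i = m then (\<lambda>x. w x / s) else u i)" for i
  have "(\<Sum>y<n. a x y * u' i y) = ev i * u' i x" if "i < Suc m" "x < n" for i x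
    using that by (cases "i = m") (auto simp: u'_def eu ew sum_divide_distrib[symmetric])
  moreover have "(\<Sum>x<n. u' i x * u' j x) = (if i = j then 1 else 0)" if "i < Suc m" "j < Suc m" for i j
  proof -
    have "(\<Sum>x<n. w x / s * (w x / s)) = 1"
      using s N by (simp add: sum_divide_distrib[symmetric] ip_def)
    moreover have "(\<Sum>x<n. w x / s * u k x) = 0" if "k < m" for k
      using ow[OF that] by (simp add: sum_divide_distrib[symmetric] ip_def)
    ultimately show ?thesis
      using that ou by (auto simp: u'_def ip_def mult.commute less_Suc_eq)
  qed
  moreover have "\<exists>d. \<forall>x<n. u' i x = (\<Sum>j<Suc m. d j * v j x)" if "i < Suc m" for i
  proof (cases "i = m")
    case True
    have "w x = v m x - (\<Sum>j<m. (\<Sum>i<m. c i * D i j) * v j x)" if "x < n" for x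
      unfolding w_def using that
      by (simp add: D sum_distrib_left sum_distrib_right mult_ac) (rule sum.swap)
    thus ?thesis
      by (intro exI[of _ "\<lambda>j. (if j = m then 1 else - (\<Sum>i<m. c i * D i j)) / s"])
        (simp add: u'_def True sum_divide_distrib[symmetric] sum_negf diff_divide_distrib)
  next
    case False
    with that have "i < m" by simp
    thus ?thesis
      by (intro exI[of _ "\<lambda>j. if j = m then 0 else D i j"]) (auto simp: u'_def D)
  qed
  moreover have "\<exists>d. \<forall>x<n. v j x = (\<Sum>i<Suc m. d i * u' i x)" if "j < Suc m" for j
  proof (cases "j = m")
    case True
    thus ?thesis using s
      by (intro exI[of _ "\<lambda>i. if i = m then s else c i"]) (auto simp: u'_def w_def)
  next
    case False
    with that have "j < m" by simp
    thus ?thesis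
      by (intro exI[of _ "\<lambda>i. if i = m then 0 else E j i"]) (auto simp: u'_def E)
  qed
  ultimately show ?case by blast
qed simp

text \<open>As the characteristic polynomial splits over the reals, the Schur decomposition
  \<open>A = P * B * Q\<close> is real. The columns of \<open>P\<close> are the triangularising
  basis, the rows of \<open>Q\<close> its dual functionals. The diagonal of \<open>B\<close> follows
  the order of \<open>es\<close>, and so do the eigenvectors.\<close>

lemma symmetric_orthonormal_eigenbasis:
  fixes A :: "real mat"
  assumes A: "A \<in> carrier_mat n n"
    and sym: "\<And>x y. x < n \<Longrightarrow> y < n \<Longrightarrow> A $$ (x, y) = A $$ (y, x)"
    and cp: "char_poly A = (\<Prod>e\<leftarrow>es. [:- e, 1:])"
  shows "\<exists>u :: nat \<Rightarrow> nat \<Rightarrow> real.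
    (\<forall>i<n. \<forall>x<n. (\<Sum>y<n. A $$ (x, y) * u i y) = es ! i * u i x) \<and>
    (\<forall>i<n. \<forall>j<n. (\<Sum>x<n. u i x * u j x) = (if i = j then 1 else 0)) \<and>
    (\<forall>f. \<forall>x<n. f x = (\<Sum>i<n. (\<Sum>y<n. f y * u i y) * u i x))"
proof -
  obtain B P Q where BPQ: "schur_decomposition A es = (B, P, Q)"
    by (metis prod_cases3)
  from schur_decomposition[OF A cp BPQ]
  have up: "upper_triangular B" and diag: "diag_mat B = es" and
    sim: "B \<in> carrier_mat n n" "P \<in> carrier_mat n n" "Q \<in> carrier_mat n n"
    "P * Q = 1\<^sub>m n" "Q * P = 1\<^sub>m n" "A = P * B * Q"
    using A by (auto simp: similar_mat_wit_def Let_def)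
  define v where "v j x = P $$ (x, j)" for j x
  have AP: "A * P = P * B"
    using sim by (simp add: assoc_mult_mat[of _ n n _ n _ n])
  have prod_entry: "(\<Sum>y<n. X $$ (x, y) * Y $$ (y, j)) = (X * Y) $$ (x, j)"
    if "X \<in> carrier_mat n n" "Y \<in> carrier_mat n n" "x < n" "j < n" for X Y :: "real mat" and x j
    using that by (auto simp: scalar_prod_def atLeast0LessThan)
  have tri: "(\<Sum>y<n. A $$ (x, y) * v j y) = es ! j * v j x + (\<Sum>i<j. B $$ (i, j) * v i x)"
    if "j < n" "x < n" for j x
  proof -
    have Bjj: "B $$ (j, j) = es ! j"
      using diag that sim(1) by (auto simp: diag_mat_def)
    have "(\<Sum>y<n. A $$ (x, y) * v j y) = (\<Sum>i<n. P $$ (x, i) * B $$ (i, j))"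
      unfolding v_def using that prod_entry[OF A sim(2)] prod_entry[OF sim(2,1)] AP by metis
    also have "\<dots> = (\<Sum>i<Suc j. P $$ (x, i) * B $$ (i, j))"
      using that up sim(1) by (intro sum.mono_neutral_right) (auto simp: upper_triangular_def)
    finally show ?thesis
      by (simp add: v_def Bjj mult_ac)
  qed
  have dual: "(\<Sum>x<n. Q $$ (i, x) * v j x) = (if i = j then 1 else 0)" if "i < n" "j < n" for i j
    unfolding v_def using that sim by (simp add: prod_entry)
  obtain u where u:
    "(\<forall>i<n. \<forall>x<n. (\<Sum>y<n. A $$ (x, y) * u i y) = es ! i * u i x) \<and>
      (\<forall>i<n. \<forall>j<n. (\<Sum>x<n. u i x * u j x) = (if i = j then 1 else 0)) \<and>
      (\<forall>i<n. \<exists>d. \<forall>x<n. u i x = (\<Sum>j<n. d j * v j x)) \<and>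
      (\<forall>j<n. \<exists>d. \<forall>x<n. v j x = (\<Sum>i<n. d i * u i x))"
    using symmetric_triangular_orthonormal_eigenvectors
      [of n "\<lambda>x y. A $$ (x, y)" v "\<lambda>j. es ! j" "\<lambda>i j. B $$ (i, j)" "\<lambda>i x. Q $$ (i, x)" n,
        OF sym tri dual order_refl] ..
  have eu: "(\<Sum>y<n. A $$ (x, y) * u i y) = es ! i * u i x" if "i < n" "x < n" for i x
    using u that by simp
  have ou: "(\<Sum>x<n. u i x * u j x) = (if i = j then 1 else 0)" if "i < n" "j < n" for i j
    using u that by simp
  have vu: "\<forall>j<n. \<exists>d. \<forall>x<n. v j x = (\<Sum>i<n. d i * u i x)"
    using u by simp
  obtain E where E: "\<And>j x. j < n \<Longrightarrow> x < n \<Longrightarrow> v j x = (\<Sum>i<n. E j i * u i x)"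
    using vu by metis
  have "f x = (\<Sum>i<n. (\<Sum>y<n. f y * u i y) * u i x)" if "x < n" for f x
  proof -
    \<comment> \<open>\<open>Q\<close> yields the coordinates of \<open>f\<close> in the basis
      \<open>v\<close>, and \<open>E\<close> converts them to the basis \<open>u\<close>;
      orthonormality then identifies them as inner products.\<close>
    define d where "d i = (\<Sum>j<n. (\<Sum>y<n. Q $$ (j, y) * f y) * E j i)" for i
    have fd: "f x = (\<Sum>i<n. d i * u i x)" if "x < n" for x
    proof -
      have "(\<Sum>i<n. d i * u i x) = (\<Sum>i<n. \<Sum>j<n. (\<Sum>y<n. Q $$ (j, y) * f y) * (E j i * u i x))"
        by (simp only: d_def sum_distrib_right mult.assoc)
      also have "\<dots> = (\<Sum>j<n. (\<Sum>y<n. Q $$ (j, y) * f y) * v j x)"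
        by (subst sum.swap) (simp add: E that sum_distrib_left)
      also have "\<dots> = (\<Sum>j<n. \<Sum>y<n. f y * (P $$ (x, j) * Q $$ (j, y)))"
        unfolding v_def sum_distrib_right by (simp add: mult_ac)
      also have "\<dots> = (\<Sum>y<n. f y * (P * Q) $$ (x, y))"
        using sim that by (subst sum.swap) (simp add: sum_distrib_left[symmetric] prod_entry del: sim(4))
      also have "\<dots> = f x"
        using that sim(4) by (simp add: if_distrib[of "(*) _"] cong: if_cong)
      finally show ?thesis by simp
    qed
    have "(\<Sum>y<n. f y * u i y) = d i" if "i < n" for i
    proof -
      have "(\<Sum>y<n. f y * u i y) = (\<Sum>y<n. \<Sum>j<n. d j * (u j y * u i y))"
        by (intro sum.cong refl) (simp only: fd lessThan_iff sum_distrib_right mult.assoc)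
      also have "\<dots> = (\<Sum>j<n. d j * (\<Sum>y<n. u j y * u i y))"
        by (subst sum.swap) (simp add: sum_distrib_left)
      also have "\<dots> = d i"
        using that by (simp add: ou if_distrib[of "(*) _"] cong: if_cong)
      finally show ?thesis .
    qed
    thus ?thesis using fd[OF that] by simp
  qed
  with eu ou show ?thesis by (intro exI[of _ u]) simp
qed

section \<open>The quadratic form of a graph and variational bounds for its eigenvalues\<close>

definition energy :: "nat pair_pre_digraph \<Rightarrow> (nat \<Rightarrow> real) \<Rightarrow> real" where
  "energy G f = (\<Sum>x<order_graph G. \<Sum>y<order_graph G. adj_matrix G $$ (x, y) * (f x * f y))"

lemma adj_matrix_sym:
  assumes "standard_graph G" and "x < order_graph G" and "y < order_graph G"
  shows "adj_matrix G $$ (x, y) = adj_matrix G $$ (y, x)"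
proof -
  interpret pair_graph G
    using assms by (simp add: standard_graph_def)
  show ?thesis
    using assms arcs_symmetric by (auto simp: adj_matrix_def)
qed

text \<open>Orthonormality, Parseval's identity and the diagonalised quadratic form are what the
  variational arguments use. The index is shifted because \<open>eig\<close> counts from 1.\<close>

lemma spectral_theorem:
  assumes "standard_graph G"
  defines "n \<equiv> order_graph G"
  shows "\<exists>u :: nat \<Rightarrow> nat \<Rightarrow> real.
    (\<forall>i<n. \<forall>j<n. (\<Sum>x<n. u i x * u j x) = (if i = j then 1 else 0)) \<and>
    (\<forall>f. (\<Sum>x<n. (f x)\<^sup>2) = (\<Sum>i<n. (\<Sum>x<n. f x * u i x)\<^sup>2)) \<and>
    (\<forall>f. energy G f = (\<Sum>i<n. eig G (Suc i) * (\<Sum>x<n. f x * u i x)\<^sup>2))"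
proof -
  let ?A = "adj_matrix G"
  have A: "?A \<in> carrier_mat n n"
    by (simp add: adj_matrix_def n_def)
  obtain u where u:
    "(\<forall>i<n. \<forall>x<n. (\<Sum>y<n. ?A $$ (x, y) * u i y) = eigenvalues G ! i * u i x) \<and>
      (\<forall>i<n. \<forall>j<n. (\<Sum>x<n. u i x * u j x) = (if i = j then 1 else 0)) \<and>
      (\<forall>f. \<forall>x<n. f x = (\<Sum>i<n. (\<Sum>y<n. f y * u i y) * u i x))"
    using symmetric_orthonormal_eigenbasis[OF A adj_matrix_sym[OF assms(1), folded n_def]
          char_poly_eigenvalues[OF assms(1)]] ..
  have eu: "(\<Sum>y<n. ?A $$ (x, y) * u i y) = eigenvalues G ! i * u i x" if "i < n" "x < n" for i x
    using u that by simp
  have cu: "f x = (\<Sum>i<n. (\<Sum>y<n. f y * u i y) * u i x)" if "x < n" for f x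
    using u that by blast
  have "(\<Sum>x<n. (f x)\<^sup>2) = (\<Sum>i<n. (\<Sum>x<n. f x * u i x)\<^sup>2)" for f
  proof -
    have "(\<Sum>x<n. (f x)\<^sup>2) = (\<Sum>x<n. f x * (\<Sum>i<n. (\<Sum>y<n. f y * u i y) * u i x))"
      unfolding power2_eq_square by (intro sum.cong refl arg_cong[of _ _ "(*) _"] cu[of _ f]) simp
    also have "\<dots> = (\<Sum>x<n. \<Sum>i<n. (\<Sum>y<n. f y * u i y) * (f x * u i x))"
      by (simp add: sum_distrib_left mult_ac)
    also have "\<dots> = (\<Sum>i<n. (\<Sum>x<n. f x * u i x)\<^sup>2)"
      by (subst sum.swap) (simp add: sum_distrib_left[symmetric] power2_eq_square)
    finally show ?thesis .
  qed
  moreover have "energy G f = (\<Sum>i<n. eig G (Suc i) * (\<Sum>x<n. f x * u i x)\<^sup>2)" for f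
  proof -
    let ?a = "\<lambda>i. \<Sum>y<n. f y * u i y"
    have row: "(\<Sum>y<n. ?A $$ (x, y) * f y) = (\<Sum>i<n. ?a i * (eigenvalues G ! i * u i x))" if "x < n" for x
    proof -
      have "(\<Sum>y<n. ?A $$ (x, y) * f y) = (\<Sum>y<n. ?A $$ (x, y) * (\<Sum>i<n. ?a i * u i y))"
        by (intro sum.cong refl arg_cong[of _ _ "(*) _"] cu[of _ f]) simp
      also have "\<dots> = (\<Sum>y<n. \<Sum>i<n. ?a i * (?A $$ (x, y) * u i y))"
        unfolding sum_distrib_left by (simp add: mult.left_commute)
      also have "\<dots> = (\<Sum>i<n. ?a i * (eigenvalues G ! i * u i x))"
        using that by (subst sum.swap) (simp add: sum_distrib_left[symmetric] eu)
      finally show ?thesis .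
    qed
    have "energy G f = (\<Sum>x<n. f x * (\<Sum>y<n. ?A $$ (x, y) * f y))"
      unfolding energy_def n_def[symmetric] by (simp add: sum_distrib_left mult_ac)
    also have "\<dots> = (\<Sum>x<n. f x * (\<Sum>i<n. ?a i * (eigenvalues G ! i * u i x)))"
      by (intro sum.cong refl) (simp add: row)
    also have "\<dots> = (\<Sum>x<n. \<Sum>i<n. (eigenvalues G ! i * ?a i) * (f x * u i x))"
      by (subst sum_distrib_left) (simp only: mult_ac)
    also have "\<dots> = (\<Sum>i<n. (eigenvalues G ! i * ?a i) * ?a i)"
      by (subst sum.swap) (simp only: sum_distrib_left[symmetric])
    finally show ?thesis
      by (simp add: eig_def power2_eq_square mult.assoc)
  qed
  ultimately show ?thesis
    using u by (intro exI[of _ u] conjI) blast+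
qed

lemma eig_antimono:
  assumes "standard_graph G" and "1 \<le> i" and "i \<le> j" and "j \<le> order_graph G"
  shows "eig G j \<le> eig G i"
  unfolding eig_def using assms by (intro eigenvalues_antimono) auto

text \<open>The lower half of Courant-Fischer: a \<open>j\<close>-dimensional test space contains a
  nonzero vector orthogonal to the top \<open>j - 1\<close> eigenvectors, and its Rayleigh quotient
  is at most \<open>eig G j\<close>. Hypothesis \<open>nz\<close> is linear independence on the
  vertex set.\<close>

lemma eig_ge_of_test_vectors:
  fixes f :: "nat \<Rightarrow> nat \<Rightarrow> real"
  assumes G: "standard_graph G" and j: "1 \<le> j" "j \<le> order_graph G"
    and nz: "\<And>c i. i < j \<Longrightarrow> c i \<noteq> 0 \<Longrightarrow> \<exists>x<order_graph G. (\<Sum>i<j. c i * f i x) \<noteq> 0"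
    and ge: "\<And>c. t * (\<Sum>x<order_graph G. (\<Sum>i<j. c i * f i x)\<^sup>2) \<le> energy G (\<lambda>x. \<Sum>i<j. c i * f i x)"
  shows "t \<le> eig G j"
proof (rule ccontr)
  assume lt: "\<not> ?thesis"
  define n where "n = order_graph G"
  obtain u where u: "(\<forall>i<n. \<forall>j<n. (\<Sum>x<n. u i x * u j x) = (if i = j then 1 else 0)) \<and>
      (\<forall>f. (\<Sum>x<n. (f x)\<^sup>2) = (\<Sum>i<n. (\<Sum>x<n. f x * u i x)\<^sup>2)) \<and>
      (\<forall>f. energy G f = (\<Sum>i<n. eig G (Suc i) * (\<Sum>x<n. f x * u i x)\<^sup>2))"
    using spectral_theorem[OF G, folded n_def] ..
  note sq = u[THEN conjunct2, THEN conjunct1, rule_format]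
  note en = u[THEN conjunct2, THEN conjunct2, rule_format]
  from j have "j - 1 < j" by simp
  \<comment> \<open>Orthogonality to the first \<open>j - 1\<close> eigenvectors is
    \<open>j - 1\<close> equations in the \<open>j\<close> coefficients.\<close>
  from homogeneous_system_solution[OF this, of "\<lambda>k i. \<Sum>x<n. f i x * u k x"]
  obtain c i where c: "i < j" "c i \<noteq> 0" and
    orth: "\<And>k. k < j - 1 \<Longrightarrow> (\<Sum>i<j. (\<Sum>x<n. f i x * u k x) * c i) = 0" by blast
  define g where "g x = (\<Sum>i<j. c i * f i x)" for x
  define a where "a k = (\<Sum>x<n. g x * u k x)" for k
  have a0: "a k = 0" if "k < j - 1" for k
  proof -
    have "a k = (\<Sum>x<n. \<Sum>i<j. f i x * u k x * c i)"
      unfolding a_def g_def sum_distrib_right by (simp only: mult_ac)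
    also have "\<dots> = 0"
      using orth[OF that] by (subst sum.swap) (simp add: sum_distrib_right)
    finally show ?thesis .
  qed
  have le: "eig G (Suc k) < t" if "a k \<noteq> 0" "k < n" for k
  proof -
    from that a0 have "\<not> k < j - 1" by auto
    hence "eig G (Suc k) \<le> eig G j"
      using j that by (intro eig_antimono G) (auto simp: n_def)
    with lt show ?thesis by simp
  qed
  have "(\<Sum>x<n. (g x)\<^sup>2) > 0"
    using nz[of i c, OF c] unfolding n_def[symmetric] g_def[symmetric]
    by (auto intro!: sum_pos2)
  hence "(\<Sum>k<n. (a k)\<^sup>2) \<noteq> 0"
    by (simp add: sq[of g] a_def)
  then obtain k where k: "k < n" "a k \<noteq> 0"
    by (metis (mono_tags, lifting) lessThan_iff sum.neutral zero_power2)
  have "energy G g = (\<Sum>k<n. eig G (Suc k) * (a k)\<^sup>2)"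
    by (simp add: en[of g] a_def)
  also have "\<dots> < (\<Sum>k<n. t * (a k)\<^sup>2)"
  proof (rule sum_strict_mono_ex1)
    show "\<forall>i\<in>{..<n}. eig G (Suc i) * (a i)\<^sup>2 \<le> t * (a i)\<^sup>2"
      using le by (metis lessThan_iff less_imp_le mult_right_mono mult_zero_right order_refl zero_le_power2 zero_power2)
    show "\<exists>i\<in>{..<n}. eig G (Suc i) * (a i)\<^sup>2 < t * (a i)\<^sup>2"
      using k le by (intro bexI[of _ k]) auto
  qed simp
  also have "\<dots> = t * (\<Sum>x<n. (g x)\<^sup>2)"
    by (simp add: sq[of g] a_def sum_distrib_left)
  finally show False
    using ge[of c] unfolding n_def[symmetric] g_def[symmetric] by simp
qed

text \<open>The span of the top two eigenvectors meets every hyperplane in a nonzero vector, whose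
  Rayleigh quotient is at least \<open>eig G 2\<close>.\<close>

lemma eig_2_le_of_hyperplane:
  assumes G: "standard_graph G" and n2: "2 \<le> order_graph G"
    and le: "\<And>f. (\<Sum>x<order_graph G. w x * f x) = 0 \<Longrightarrow> energy G f \<le> B * (\<Sum>x<order_graph G. (f x)\<^sup>2)"
  shows "eig G 2 \<le> B"
proof (rule ccontr)
  assume gt: "\<not> ?thesis"
  define n where "n = order_graph G"
  obtain u where u: "(\<forall>i<n. \<forall>j<n. (\<Sum>x<n. u i x * u j x) = (if i = j then 1 else 0)) \<and>
      (\<forall>f. (\<Sum>x<n. (f x)\<^sup>2) = (\<Sum>i<n. (\<Sum>x<n. f x * u i x)\<^sup>2)) \<and>
      (\<forall>f. energy G f = (\<Sum>i<n. eig G (Suc i) * (\<Sum>x<n. f x * u i x)\<^sup>2))"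
    using spectral_theorem[OF G, folded n_def] ..
  note sq = u[THEN conjunct2, THEN conjunct1, rule_format]
  note en = u[THEN conjunct2, THEN conjunct2, rule_format]
  note ou = u[THEN conjunct1, rule_format]
  from homogeneous_system_solution[of 1 2 "\<lambda>_ j. \<Sum>x<n. w x * u j x"]
  obtain c k where c: "k < 2" "c k \<noteq> 0" "(\<Sum>j<2. (\<Sum>x<n. w x * u j x) * c j) = 0" by auto
  define g where "g x = (\<Sum>j<2. c j * u j x)" for x
  have "(\<Sum>x<n. w x * g x) = (\<Sum>x<n. \<Sum>j<2. w x * u j x * c j)"
    unfolding g_def sum_distrib_left by (simp add: mult_ac)
  also have "\<dots> = 0"
    using c(3) by (subst sum.swap) (simp add: sum_distrib_right)
  finally have en_le: "energy G g \<le> B * (\<Sum>x<n. (g x)\<^sup>2)"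
    using le by (simp add: n_def)
  have coeff: "(\<Sum>x<n. g x * u i x) = (if i < 2 then c i else 0)" if "i < n" for i
  proof -
    have "(\<Sum>x<n. g x * u i x) = (\<Sum>x<n. \<Sum>j<2. c j * (u j x * u i x))"
      unfolding g_def sum_distrib_right by (simp add: mult_ac)
    also have "\<dots> = (\<Sum>j<2. c j * (\<Sum>x<n. u j x * u i x))"
      by (subst sum.swap) (simp only: sum_distrib_left)
    also have "\<dots> = (\<Sum>j<2. c j * (if j = i then 1 else 0))"
      using that n2[folded n_def] by (intro sum.cong refl) (simp add: ou)
    also have "\<dots> = (if i < 2 then c i else 0)"
      by (simp add: if_distrib[of "(*) _"] cong: if_cong)
    finally show ?thesis .
  qed
  have restrict: "(\<Sum>i<n. h i * (if i < 2 then c i else 0)\<^sup>2) = (\<Sum>i<2. h i * (c i)\<^sup>2)" for h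
    using n2 by (intro sum.mono_neutral_cong_right) (auto simp: n_def)
  have "B * (\<Sum>x<n. (g x)\<^sup>2) = (\<Sum>i<2. B * (c i)\<^sup>2)"
    by (simp add: sq[of g] coeff sum_distrib_left restrict)
  also have "\<dots> < (\<Sum>i<2. eig G (Suc i) * (c i)\<^sup>2)"
  proof -
    have lt: "B < eig G (Suc i)" if "i < 2" for i
    proof -
      have "eig G 2 \<le> eig G (Suc i)"
        using that n2 by (intro eig_antimono[OF G]) auto
      with gt show ?thesis by simp
    qed
    show ?thesis
    proof (rule sum_strict_mono_ex1)
      show "\<forall>i\<in>{..<2}. B * (c i)\<^sup>2 \<le> eig G (Suc i) * (c i)\<^sup>2"
        using mult_right_mono[OF less_imp_le[OF lt]] by simp
      show "\<exists>i\<in>{..<2}. B * (c i)\<^sup>2 < eig G (Suc i) * (c i)\<^sup>2"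
        using c lt by (intro bexI[of _ k]) auto
    qed simp
  qed
  also have "\<dots> = energy G g"
    by (simp add: en[of g] coeff restrict)
  finally show False using en_le by simp
qed

section \<open>The triangulated necklace\<close>

abbreviation block_length :: "nat \<Rightarrow> nat" where
  "block_length T \<equiv> 2 * T + 4"

text \<open>Path edges start at 5 since those below lie in the clique on \<open>{0..5}\<close>.\<close>

definition step :: "nat \<Rightarrow> nat \<Rightarrow> nat \<Rightarrow> bool" where
  "step T u v \<longleftrightarrow> v = u + 1 \<and> 5 \<le> u \<or>
    v = u + 2 \<and> block_length T \<le> u \<and> u mod block_length T = T"

text \<open>The necklace without its clique, kept separate because the bound on the second
  eigenvalue reduces to this part.\<close>

definition link :: "nat \<Rightarrow> nat \<Rightarrow> nat \<Rightarrow> bool" where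
  "link T u v \<longleftrightarrow> step T u v \<or> step T v u"

definition necklace_adj :: "nat \<Rightarrow> nat \<Rightarrow> nat \<Rightarrow> bool" where
  "necklace_adj T u v \<longleftrightarrow> u < 6 \<and> v < 6 \<and> u \<noteq> v \<or> link T u v"

definition necklace :: "nat \<Rightarrow> nat \<Rightarrow> nat pair_pre_digraph" where
  "necklace T k = \<lparr>pverts = {0..<k * block_length T},
    parcs = {(u, v). u < k * block_length T \<and> v < k * block_length T \<and> necklace_adj T u v}\<rparr>"

lemma pverts_necklace [simp]: "pverts (necklace T k) = {0..<k * block_length T}"
  by (simp add: necklace_def)

lemma link_sym: "link T u v \<longleftrightarrow> link T v u"
  by (auto simp: link_def)

lemma standard_necklace: "standard_graph (necklace T k)"
proof -
  have "finite (parcs (necklace T k))"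
    by (rule finite_subset[of _ "{..<k * block_length T} \<times> {..<k * block_length T}"])
      (auto simp: necklace_def)
  hence "pair_graph (necklace T k)"
    by unfold_locales
      (auto simp: necklace_def necklace_adj_def link_def step_def symmetric_def sym_def)
  thus ?thesis
    by (simp add: standard_graph_def necklace_def)
qed

lemma connected_necklace:
  assumes "k \<ge> 1"
  shows "Digraph_Component.connected (with_proj (necklace T k))"
proof -
  let ?n = "k * block_length T" and ?G = "necklace T k"
  let ?R = "rtrancl_on (pverts ?G) ((parcs ?G)\<^sup>s)"
  interpret pair_graph ?G
    using standard_necklace by (simp add: standard_graph_def)
  \<comment> \<open>Consecutive vertices are joined by the clique when \<open>u < 5\<close> and by
    the path from 5 on.\<close>
  have edge: "(u, Suc u) \<in> (parcs ?G)\<^sup>s" "(Suc u, u) \<in> (parcs ?G)\<^sup>s" if "Suc u < ?n" for u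
    using that by (auto simp: symcl_def necklace_def necklace_adj_def link_def step_def)
  have R: "(0, u) \<in> ?R \<and> (u, 0) \<in> ?R" if "u < ?n" for u
    using that
  proof (induction u)
    case 0
    thus ?case by auto
  next
    case (Suc u)
    hence "Suc u \<in> pverts ?G" by simp
    thus ?case
      using Suc edge[of u]
      by (auto intro: rtrancl_on_into_rtrancl_on converse_rtrancl_on_into_rtrancl_on)
  qed
  have "(u, v) \<in> ?R" if "u < ?n" "v < ?n" for u v
    using R[OF that(1), THEN conjunct2] R[OF that(2), THEN conjunct1] by (rule rtrancl_on_trans)
  thus ?thesis
    unfolding connected_conv using assms by simp
qed

lemma out_degree_necklace:
  "out_degree (with_proj (necklace T k)) v =
    (if v < k * block_length T then card {w. w < k * block_length T \<and> necklace_adj T v w} else 0)"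
proof -
  have "out_arcs (with_proj (necklace T k)) v =
    Pair v ` {w. v < k * block_length T \<and> w < k * block_length T \<and> necklace_adj T v w}"
    by (auto simp: necklace_def)
  thus ?thesis
    by (simp add: out_degree_def card_image inj_on_def)
qed

text \<open>The maximum is attained at vertex 5, which has five neighbours in the clique and vertex
  6 on the path; two blocks ensure that vertex 6 exists.\<close>

lemma max_degree_necklace:
  assumes "T \<ge> 1" and "k \<ge> 2"
  shows "max_degree (necklace T k) = 6"
proof -
  let ?n = "k * block_length T"
  have "2 * block_length T \<le> ?n"
    using assms by (intro mult_right_mono) auto
  hence n: "12 \<le> ?n" using assms by simp
  have le: "card {w. w < ?n \<and> necklace_adj T v w} \<le> 6" if "v < ?n" for v
  proof (cases "v < 6")
    case True
    have "card {w. w < ?n \<and> necklace_adj T v w} \<le> card ({0..<7} - {v})"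
      using True assms by (intro card_mono) (auto simp: necklace_adj_def link_def step_def)
    thus ?thesis using True by (simp add: card_Diff_singleton)
  next
    case False
    have "card {w. w < ?n \<and> necklace_adj T v w} \<le> card (set [v + 1, v - 1, v + 2, v - 2])"
      using False assms by (intro card_mono) (auto simp: necklace_adj_def link_def step_def)
    also have "\<dots> \<le> length [v + 1, v - 1, v + 2, v - 2]"
      by (rule card_length)
    finally show ?thesis by simp
  qed
  have "{w. w < ?n \<and> necklace_adj T 5 w} = {0, 1, 2, 3, 4, 6}"
    using assms n by (auto simp: necklace_adj_def link_def step_def)
  hence "card {w. w < ?n \<and> necklace_adj T 5 w} = 6" by simp
  hence 6: "out_degree (with_proj (necklace T k)) 5 = 6"
    using n by (simp add: out_degree_necklace)
  show ?thesis
    unfolding max_degree_def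
  proof (rule Max_eqI)
    show "6 \<in> out_degree (with_proj (necklace T k)) ` pverts (necklace T k)"
      using 6 n by (intro image_eqI[of _ _ 5]) auto
  qed (use le in \<open>auto simp: out_degree_necklace\<close>)
qed

lemma adj_matrix_necklace:
  assumes "x < k * block_length T" and "y < k * block_length T"
  shows "adj_matrix (necklace T k) $$ (x, y) = of_bool (necklace_adj T x y)"
  using assms by (auto simp: adj_matrix_def necklace_def)

section \<open>Decaying profiles\<close>

text \<open>
  For \<open>\<sigma> = 1\<close> and \<open>\<sigma> = -1\<close> these are, up to scaling, the hyperbolic cosine and sine of the
  distance to the middle of the path joining two triangles: the sum respectively difference of
  the decaying modes of the two neighbouring triangles.
\<close>

definition path_profile :: "real \<Rightarrow> nat \<Rightarrow> real \<Rightarrow> nat \<Rightarrow> real" where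
  "path_profile r T \<sigma> d = r ^ (2 * T + 2 - d) + \<sigma> * r ^ d"

text \<open>In a block the triangle is on positions \<open>T\<close>, \<open>T + 1\<close>,
  \<open>T + 2\<close>, with \<open>T + 1\<close> as its apex, and \<open>path_profile\<close> is
  evaluated at the distance to the base. The last position \<open>2 * T + 3\<close> is midway
  between two triangles, at distance \<open>T + 1\<close> from each.\<close>

definition block_profile :: "real \<Rightarrow> nat \<Rightarrow> real \<Rightarrow> nat \<Rightarrow> real" where
  "block_profile r T \<sigma> s =
    (if s = T + 1 then (r - 1) * path_profile r T \<sigma> 0
     else path_profile r T \<sigma> (if s \<le> T then T - s else s - (T + 2)))"

text \<open>The number \<open>r\<close> is the tribonacci constant, about 1.839. The bound 9/5
  suffices for \<open>r\<^sup>2 \<ge> 3\<close>.\<close>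

locale tribonacci_root =
  fixes r :: real
  assumes lower: "9 / 5 \<le> r" and upper: "r \<le> 2" and root: "r ^ 3 = r\<^sup>2 + r + 1"
begin

definition \<theta> :: real where "\<theta> = r + 1 / r"

lemma pos: "r > 0" using lower by simp

text \<open>The eigenvalue equation at the apex: value \<open>r - 1\<close>, and two neighbours of
  value 1. It is equivalent to the cubic equation for \<open>r\<close>.\<close>

lemma theta_mult: "\<theta> * (r - 1) = 2"
proof -
  have "r * (\<theta> * (r - 1)) = r * 2"
    using root pos by (simp add: \<theta>_def field_simps power2_eq_square power3_eq_cube)
  thus ?thesis using pos by simp
qed

lemma theta_bounds: "2 \<le> \<theta>" "\<theta> \<le> 5 / 2"
proof -
  show "2 \<le> \<theta>"
    using theta_mult lower upper mult_left_mono[of "r - 1" 1 \<theta>] pos by (simp add: \<theta>_def)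
  have "\<theta> * (4 / 5) \<le> \<theta> * (r - 1)"
    using lower pos by (intro mult_left_mono) (auto simp: \<theta>_def)
  thus "\<theta> \<le> 5 / 2" by (simp add: theta_mult)
qed

text \<open>With \<theta> equal to \<open>r + 1 / r\<close>, both the growing mode and the decaying
  mode solve this recurrence.\<close>

lemma path_profile_rec:
  assumes "1 \<le> d" and "d \<le> 2 * T + 1"
  shows "path_profile r T \<sigma> (d - 1) + path_profile r T \<sigma> (d + 1) = \<theta> * path_profile r T \<sigma> d"
proof -
  obtain e where e: "d = e + 1" using assms by (metis add.commute le_Suc_ex)
  obtain h where h: "2 * T + 1 = d + h" using assms le_Suc_ex by blast
  have "2 * T + 2 - (d - 1) = h + 2" "2 * T + 2 - (d + 1) = h" "2 * T + 2 - d = h + 1" "d - 1 = e"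
    using e h by auto
  thus ?thesis
    unfolding path_profile_def \<theta>_def using pos
    by (simp add: e field_simps power2_eq_square)
qed

text \<open>The mode decaying away from the triangle satisfies the equation at a base vertex
  exactly; the mode coming from the other triangle leaves the residual
  \<open>\<sigma> * (r - 1 / r)\<close>.\<close>

lemma path_profile_triangle:
  "path_profile r T \<sigma> 1 + (r - 1) * path_profile r T \<sigma> 0 + path_profile r T \<sigma> 0 =
    \<theta> * path_profile r T \<sigma> 0 + \<sigma> * (r - 1 / r)"
  using pos by (simp add: path_profile_def \<theta>_def field_simps)

text \<open>The even profile is symmetric about the midpoint, so both neighbours of the midpoint
  carry the same value.\<close>

lemma path_profile_middle: "2 * path_profile r T 1 T = \<theta> * path_profile r T 1 (T + 1)"
proof -
  have "2 * T + 2 - T = T + 2" by simp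
  thus ?thesis
    using pos by (simp add: path_profile_def \<theta>_def field_simps power2_eq_square)
qed

text \<open>The profile is an eigenfunction up to the residual at the two base vertices, with
  positions read cyclically. For the odd profile the last position is excluded: its value there is
  0, while the cyclic reading gives its two neighbours equal values of the same sign.\<close>

lemma block_profile_neighbours:
  assumes "s < block_length T" and "T \<ge> 1" and "s < block_length T - 1 \<or> \<sigma> = 1"
  shows "block_profile r T \<sigma> (if s = 0 then block_length T - 1 else s - 1) +
      block_profile r T \<sigma> (if s + 1 = block_length T then 0 else s + 1) +
      of_bool (s = T) * block_profile r T \<sigma> (T + 2) + of_bool (s = T + 2) * block_profile r T \<sigma> T =
    \<theta> * block_profile r T \<sigma> s + of_bool (s = T \<or> s = T + 2) * (\<sigma> * (r - 1 / r))"
proof -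
  let ?F = "path_profile r T \<sigma>"
  consider "s < T" | "s = T" | "s = T + 1" | "s = T + 2" | "T + 2 < s" "s < 2 * T + 3" | "s = 2 * T + 3"
    using assms(1) by linarith
  thus ?thesis
  proof cases
    case 1
    have "block_profile r T \<sigma> (if s = 0 then block_length T - 1 else s - 1) = ?F (T - s + 1)"
      using 1 by (auto simp: block_profile_def Suc_diff_le)
    moreover have "block_profile r T \<sigma> (s + 1) = ?F (T - s - 1)"
      using 1 by (simp add: block_profile_def)
    moreover have "?F (T - s - 1) + ?F (T - s + 1) = \<theta> * ?F (T - s)"
      using 1 by (intro path_profile_rec) auto
    ultimately show ?thesis
      using 1 by (simp add: block_profile_def)
  next
    case 2
    thus ?thesis
      using assms(2) path_profile_triangle[of T \<sigma>] by (auto simp: block_profile_def)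
  next
    case 3
    have "?F 0 + ?F 0 = (\<theta> * (r - 1)) * ?F 0"
      by (simp add: theta_mult)
    with 3 show ?thesis
      by (simp add: block_profile_def)
  next
    case 4
    thus ?thesis
      using assms(2) path_profile_triangle[of T \<sigma>] by (auto simp: block_profile_def)
  next
    case 5
    have "s - 1 - (T + 2) = s - (T + 2) - 1" "s + 1 - (T + 2) = s - (T + 2) + 1" using 5 by auto
    moreover have "s - 1 \<noteq> T + 1" "\<not> s - 1 \<le> T" using 5 by auto
    ultimately show ?thesis
      using 5 path_profile_rec[of "s - (T + 2)" T \<sigma>] by (simp add: block_profile_def)
  next
    case 6
    hence "\<sigma> = 1" using assms(3) by simp
    with 6 show ?thesis
      using assms(2) path_profile_middle[of T] by (simp add: block_profile_def)
  qed
qed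

text \<open>Bounds the residual relative to the value at a base vertex. The residual is at most 3/2
  and, for either sign, the base value is at least half of \<open>r ^ (2 * T + 2)\<close>; hence the
  numerator 3.\<close>

definition \<epsilon> :: "nat \<Rightarrow> real" where "\<epsilon> T = 3 / r ^ (2 * T + 2)"

lemma decay_le: "r - 1 / r \<le> 3 / 2"
proof -
  have "1 / 2 \<le> 1 / r" using upper pos by (simp add: field_simps)
  thus ?thesis using upper by simp
qed

lemma power_ge: "2 \<le> r ^ (2 * T + 2)"
proof -
  have "9 / 5 * (9 / 5) \<le> r * r" using lower by (intro mult_mono) auto
  hence "2 \<le> r\<^sup>2" by (simp add: power2_eq_square)
  also have "\<dots> \<le> r ^ (2 * T + 2)" using lower by (intro power_increasing) auto
  finally show ?thesis .
qed

lemma cosh_excess: "r - 1 / r \<le> \<epsilon> T * path_profile r T 1 0"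
proof -
  have "r - 1 / r \<le> 3 / r ^ (2 * T + 2) * r ^ (2 * T + 2)"
    using decay_le pos by simp
  also have "\<dots> \<le> \<epsilon> T * path_profile r T 1 0"
    unfolding \<epsilon>_def path_profile_def using pos by (intro mult_left_mono) auto
  finally show ?thesis .
qed

lemma sinh_deficit: "r - 1 / r \<le> \<epsilon> T * path_profile r T (-1) 0" "0 < path_profile r T (-1) 0"
proof -
  have "\<epsilon> T * path_profile r T (-1) 0 = 3 - 3 / r ^ (2 * T + 2)"
    unfolding \<epsilon>_def path_profile_def using pos by (simp add: right_diff_distrib)
  moreover have "3 / r ^ (2 * T + 2) \<le> 3 / 2"
    using power_ge[of T] pos by (intro divide_left_mono) auto
  ultimately show "r - 1 / r \<le> \<epsilon> T * path_profile r T (-1) 0"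
    using decay_le by linarith
  have "path_profile r T (-1) 0 = r ^ (2 * T + 2) - 1"
    by (simp add: path_profile_def)
  thus "0 < path_profile r T (-1) 0"
    using power_ge[of T] by linarith
qed

lemma path_profile_pos: "path_profile r T 1 d > 0"
  using pos by (auto simp: path_profile_def intro: add_pos_pos)

lemma block_profile_pos: "block_profile r T 1 s > 0"
  using path_profile_pos lower by (auto simp: block_profile_def)

lemma block_profile_sinh_end: "block_profile r T (-1) (2 * T + 3) = 0"
  by (simp add: block_profile_def path_profile_def)

end

section \<open>Residues and quotients of neighbouring positions\<close>

lemma mod_neighbours:
  fixes u L :: nat
  assumes "L \<ge> 1"
  shows "(u + 1) mod L = (if u mod L + 1 = L then 0 else u mod L + 1)"
    and "u \<ge> 1 \<Longrightarrow> (u - 1) mod L = (if u mod L = 0 then L - 1 else u mod L - 1)"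
proof -
  show suc: "(u + 1) mod L = (if u mod L + 1 = L then 0 else u mod L + 1)" for u
    by (simp add: mod_Suc)
  show "(u - 1) mod L = (if u mod L = 0 then L - 1 else u mod L - 1)" if "u \<ge> 1"
    using suc[of "u - 1"] that by (auto split: if_splits)
qed

lemma div_neighbours:
  fixes u L :: nat
  assumes "u mod L + 1 < L"
  shows "(u + 1) div L = u div L"
    and "u mod L \<ge> 1 \<Longrightarrow> (u - 1) div L = u div L"
proof -
  have suc: "(v + 1) div L = v div L" if "v mod L + 1 < L" for v
  proof -
    define m where "m = v mod L"
    have "m + 1 < L" using that by (simp only: m_def)
    hence "(v + 1) mod L = m + 1"
      using mod_neighbours(1)[of L v, folded m_def] by simp
    hence "Suc v mod L \<noteq> 0" by simp
    thus ?thesis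
      unfolding Suc_eq_plus1[symmetric] div_Suc by (rule if_not_P)
  qed
  show "(u + 1) div L = u div L" by (rule suc[OF assms])
  show "(u - 1) div L = u div L" if "u mod L \<ge> 1"
  proof -
    define m where "m = u mod L"
    have m: "1 \<le> m" "m + 1 < L" using assms that by (simp_all only: m_def)
    have "u \<ge> 1" using that by (cases u) auto
    hence "(u - 1) mod L = m - 1"
      using m mod_neighbours(2)[of L u, folded m_def] by simp
    with m have "(u - 1) mod L + 1 < L" by simp
    from suc[OF this] show ?thesis
      using \<open>u \<ge> 1\<close> by simp
  qed
qed

lemma chord_residue:
  assumes "u mod block_length T = T"
  shows "(u + 2) mod block_length T = T + 2" "(u + 2) div block_length T = u div block_length T"
proof -
  define q where "q = u div block_length T"
  have "u + 2 = (T + 2) + block_length T * q"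
    using assms mult_div_mod_eq[of "block_length T" u] unfolding q_def by linarith
  moreover have "((T + 2) + block_length T * q) mod block_length T = T + 2"
    by (subst mod_mult_self2) simp
  moreover have "((T + 2) + block_length T * q) div block_length T = q"
    by (subst div_mult_self2) simp_all
  ultimately show "(u + 2) mod block_length T = T + 2" "(u + 2) div block_length T = u div block_length T"
    by (simp_all only: q_def)
qed

lemma chord_residue':
  assumes "u mod block_length T = T + 2"
  shows "2 \<le> u" "(u - 2) mod block_length T = T" "(u - 2) div block_length T = u div block_length T"
proof -
  define q where "q = u div block_length T"
  have u: "u = (T + 2) + block_length T * q"
    using assms mult_div_mod_eq[of "block_length T" u] unfolding q_def by linarith
  thus "2 \<le> u" by linarith
  from u have "u - 2 = T + block_length T * q" by linarith
  moreover have "(T + block_length T * q) mod block_length T = T"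
    by (subst mod_mult_self2) simp
  moreover have "(T + block_length T * q) div block_length T = q"
    by (subst div_mult_self2) simp_all
  ultimately show "(u - 2) mod block_length T = T" "(u - 2) div block_length T = u div block_length T"
    by (simp_all only: q_def)
qed

section \<open>Eigenvalues of the necklace\<close>

lemma sum_at:
  fixes y :: "nat \<Rightarrow> real"
  shows "(\<Sum>v<n. of_bool (v = a \<and> P) * y v) = of_bool (a < n \<and> P) * y a"
proof -
  have "(\<Sum>v<n. of_bool (v = a \<and> P) * y v) = (\<Sum>v<n. if v = a then of_bool P * y v else 0)"
    by (intro sum.cong refl) auto
  thus ?thesis by simp
qed

lemma necklace_size: "T \<ge> 1 \<Longrightarrow> k \<ge> 1 \<Longrightarrow> 6 \<le> k * block_length T"
  using mult_le_mono[of 1 k 6 "block_length T"] by simp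

text \<open>Near the clique and at the two ends some of these neighbours are missing. For
  nonnegative \<open>y\<close> that only lowers the sum, so the periodic formula is an upper bound
  at every vertex.\<close>

lemma link_neighbour_sum_le:
  fixes y :: "nat \<Rightarrow> real"
  assumes y: "\<And>v. 0 \<le> y v"
  shows "(\<Sum>v<n. of_bool (link T u v) * y v) \<le>
    of_bool (1 \<le> u) * y (u - 1) + y (u + 1) +
    of_bool (u mod block_length T = T) * y (u + 2) +
    of_bool (u mod block_length T = T + 2) * y (u - 2)"
proof -
  let ?L = "block_length T"
  have "(of_bool (link T u v) :: real) \<le>
      of_bool (v = u - 1 \<and> 1 \<le> u) + of_bool (v = u + 1 \<and> True) +
      of_bool (v = u + 2 \<and> u mod ?L = T) + of_bool (v = u - 2 \<and> u mod ?L = T + 2)" for v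
  proof (cases "link T u v")
    case True
    hence "v = u - 1 \<and> 1 \<le> u \<or> v = u + 1 \<or> v = u + 2 \<and> u mod ?L = T \<or> v = u - 2 \<and> u mod ?L = T + 2"
      using chord_residue(1)[of v T] unfolding link_def step_def by (elim disjE) auto
    thus ?thesis
      unfolding of_bool_def by (elim disjE) simp_all
  qed simp
  from mult_right_mono[OF this y]
  have le: "of_bool (link T u v) * y v \<le>
      of_bool (v = u - 1 \<and> 1 \<le> u) * y v + of_bool (v = u + 1 \<and> True) * y v +
      of_bool (v = u + 2 \<and> u mod ?L = T) * y v + of_bool (v = u - 2 \<and> u mod ?L = T + 2) * y v" for v
    unfolding distrib_right .
  have "(\<Sum>v<n. of_bool (link T u v) * y v) \<le> (\<Sum>v<n.
      of_bool (v = u - 1 \<and> 1 \<le> u) * y v + of_bool (v = u + 1 \<and> True) * y v +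
      of_bool (v = u + 2 \<and> u mod ?L = T) * y v + of_bool (v = u - 2 \<and> u mod ?L = T + 2) * y v)"
    by (rule sum_mono) (rule le)
  also have "\<dots> = of_bool (u - 1 < n \<and> 1 \<le> u) * y (u - 1) + of_bool (u + 1 < n \<and> True) * y (u + 1) +
      of_bool (u + 2 < n \<and> u mod ?L = T) * y (u + 2) + of_bool (u - 2 < n \<and> u mod ?L = T + 2) * y (u - 2)"
    unfolding sum.distrib sum_at ..
  also have "\<dots> \<le> of_bool (1 \<le> u) * y (u - 1) + of_bool True * y (u + 1) + of_bool (u mod ?L = T) * y (u + 2) +
      of_bool (u mod ?L = T + 2) * y (u - 2)"
    by (intro add_mono mult_right_mono y) (simp_all only: of_bool_def split: if_splits, simp_all)
  finally show ?thesis by (simp only: of_bool_eq mult_1)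
qed

text \<open>Past the first block no neighbour is missing. The equality serves test vectors whose
  values may have either sign.\<close>

lemma necklace_neighbour_sum:
  fixes y :: "nat \<Rightarrow> real"
  assumes T: "T \<ge> 1" and u: "block_length T \<le> u" "u + 1 < n"
    and n: "u mod block_length T = T \<Longrightarrow> u + 2 < n"
  shows "(\<Sum>v<n. of_bool (necklace_adj T u v) * y v) =
    y (u - 1) + y (u + 1) +
    of_bool (u mod block_length T = T) * y (u + 2) +
    of_bool (u mod block_length T = T + 2) * y (u - 2)"
proof -
  let ?L = "block_length T"
  have u6: "6 \<le> u" using u T by simp
  have far: "?L \<le> u - 2" "(u - 2) mod ?L = T" if "u mod ?L = T + 2"
  proof -
    have "0 < u div ?L"
      using u by (intro div_greater_zero_iff[THEN iffD2]) auto
    hence "0 < (u - 2) div ?L" using chord_residue'(3)[OF that] by (simp only:)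
    thus "?L \<le> u - 2" by (simp only: div_greater_zero_iff)
    show "(u - 2) mod ?L = T" by (rule chord_residue'(2)[OF that])
  qed
  \<comment> \<open>The four candidate neighbours are pairwise distinct, since
    \<open>u \<ge> 6\<close> rules out truncated subtraction; so at most one indicator is 1.\<close>
  have "(of_bool (necklace_adj T u v) :: real) = of_bool (v = u - 1 \<and> True) + of_bool (v = u + 1 \<and> True) +
      of_bool (v = u + 2 \<and> u mod ?L = T) + of_bool (v = u - 2 \<and> u mod ?L = T + 2)" for v
  proof -
    have fwd: "v = u - 1 \<or> v = u + 1 \<or> v = u + 2 \<and> u mod ?L = T \<or> v = u - 2 \<and> u mod ?L = T + 2"
      if "necklace_adj T u v"
      using that u6 chord_residue(1)[of v T] unfolding necklace_adj_def link_def step_def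
      by (elim disjE) auto
    have "necklace_adj T u (u - 1)" "necklace_adj T u (u + 1)"
      using u6 by (auto simp: necklace_adj_def link_def step_def)
    moreover have "necklace_adj T u (u + 2)" if "u mod ?L = T"
      using that u by (auto simp: necklace_adj_def link_def step_def)
    moreover have "necklace_adj T u (u - 2)" if "u mod ?L = T + 2"
    proof -
      have "u = u - 2 + 2" using u6 by simp
      with far[OF that] show ?thesis
        unfolding necklace_adj_def link_def step_def by blast
    qed
    moreover have "u - 1 \<noteq> u + 1" "u - 1 \<noteq> u + 2" "u - 1 \<noteq> u - 2" "u + 1 \<noteq> u + 2" "u + 1 \<noteq> u - 2"
      "u + 2 \<noteq> u - 2"
      using u6 by auto
    ultimately consider "\<not> necklace_adj T u v" "v \<noteq> u - 1" "v \<noteq> u + 1"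
        "\<not> (v = u + 2 \<and> u mod ?L = T)" "\<not> (v = u - 2 \<and> u mod ?L = T + 2)"
      | "necklace_adj T u v" "v = u - 1" "v \<noteq> u + 1" "v \<noteq> u + 2" "v \<noteq> u - 2"
      | "necklace_adj T u v" "v = u + 1" "v \<noteq> u - 1" "v \<noteq> u + 2" "v \<noteq> u - 2"
      | "necklace_adj T u v" "v = u + 2" "u mod ?L = T" "v \<noteq> u - 1" "v \<noteq> u + 1" "v \<noteq> u - 2"
      | "necklace_adj T u v" "v = u - 2" "u mod ?L = T + 2" "v \<noteq> u - 1" "v \<noteq> u + 1" "v \<noteq> u + 2"
      using fwd by metis
    thus ?thesis
      by cases (simp_all only: of_bool_eq simp_thms add_0_left add_0_right)
  qed
  hence "(\<Sum>v<n. of_bool (necklace_adj T u v) * y v) = (\<Sum>v<n.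
      of_bool (v = u - 1 \<and> True) * y v + of_bool (v = u + 1 \<and> True) * y v +
      of_bool (v = u + 2 \<and> u mod ?L = T) * y v + of_bool (v = u - 2 \<and> u mod ?L = T + 2) * y v)"
    by (simp only: distrib_right)
  also have "\<dots> = of_bool (u - 1 < n \<and> True) * y (u - 1) + of_bool (u + 1 < n \<and> True) * y (u + 1) +
      of_bool (u + 2 < n \<and> u mod ?L = T) * y (u + 2) + of_bool (u - 2 < n \<and> u mod ?L = T + 2) * y (u - 2)"
    unfolding sum.distrib sum_at ..
  also have "u + 2 < n \<and> u mod ?L = T \<longleftrightarrow> u mod ?L = T" using n by blast
  also have "u - 2 < n \<and> u mod ?L = T + 2 \<longleftrightarrow> u mod ?L = T + 2" using u by auto
  also have "u - 1 < n \<and> True \<longleftrightarrow> True" using u by auto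
  also have "u + 1 < n \<and> True \<longleftrightarrow> True" using u by auto
  finally show ?thesis
    by (simp only: of_bool_eq mult_1)
qed

text \<open>AM--GM on each edge, weighted by the supersolution \<open>y\<close>.\<close>

lemma quadratic_form_le_of_supersolution:
  fixes E :: "nat \<Rightarrow> nat \<Rightarrow> bool" and y :: "nat \<Rightarrow> real"
  assumes sym: "\<And>u v. E u v = E v u" and y: "\<And>u. 0 < y u"
    and super: "\<And>u. u < n \<Longrightarrow> (\<Sum>v<n. of_bool (E u v) * y v) \<le> B * y u"
  shows "(\<Sum>u<n. \<Sum>v<n. of_bool (E u v) * (f u * f v)) \<le> B * (\<Sum>u<n. (f u)\<^sup>2)"
proof -
  have amgm: "2 * (f u * f v) \<le> (f u)\<^sup>2 * (y v / y u) + (f v)\<^sup>2 * (y u / y v)" for u v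
  proof -
    have "0 \<le> (f u * y v - f v * y u)\<^sup>2 / (y u * y v)"
      using y[of u] y[of v] by simp
    also have "\<dots> = (f u)\<^sup>2 * (y v / y u) + (f v)\<^sup>2 * (y u / y v) - 2 * (f u * f v)"
      using y[of u] y[of v] by (simp add: field_simps power2_eq_square)
    finally show ?thesis by simp
  qed
  let ?S = "\<Sum>u<n. \<Sum>v<n. of_bool (E u v) * ((f u)\<^sup>2 * (y v / y u))"
  have swap: "(\<Sum>u<n. \<Sum>v<n. of_bool (E u v) * ((f v)\<^sup>2 * (y u / y v))) = ?S"
    by (subst sum.swap) (simp only: sym)
  have "2 * (\<Sum>u<n. \<Sum>v<n. of_bool (E u v) * (f u * f v)) =
      (\<Sum>u<n. \<Sum>v<n. of_bool (E u v) * (2 * (f u * f v)))"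
    by (simp add: sum_distrib_left mult_ac)
  also have "\<dots> \<le> (\<Sum>u<n. \<Sum>v<n. of_bool (E u v) * ((f u)\<^sup>2 * (y v / y u) + (f v)\<^sup>2 * (y u / y v)))"
    using amgm by (intro sum_mono mult_left_mono) auto
  also have "\<dots> = 2 * ?S"
    unfolding distrib_left sum.distrib swap by simp
  finally have "(\<Sum>u<n. \<Sum>v<n. of_bool (E u v) * (f u * f v)) \<le> ?S" by simp
  also have "?S = (\<Sum>u<n. (f u)\<^sup>2 / y u * (\<Sum>v<n. of_bool (E u v) * y v))"
    unfolding sum_distrib_left by (intro sum.cong refl) (simp add: of_bool_def)
  also have "\<dots> \<le> (\<Sum>u<n. (f u)\<^sup>2 / y u * (B * y u))"
    by (intro sum_mono mult_left_mono super divide_nonneg_pos y) auto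
  also have "\<dots> = B * (\<Sum>u<n. (f u)\<^sup>2)"
    using y by (simp add: sum_distrib_left less_imp_neq[OF y, symmetric] mult_ac)
  finally show ?thesis .
qed

text \<open>The clique's matrix is all-ones minus identity. The form is therefore nonpositive on
  vectors with sum zero over the clique.\<close>

lemma clique_form:
  fixes f :: "nat \<Rightarrow> real"
  assumes "m \<le> n"
  shows "(\<Sum>u<n. \<Sum>v<n. of_bool (u < m \<and> v < m \<and> u \<noteq> v) * (f u * f v)) =
    (\<Sum>u<m. f u)\<^sup>2 - (\<Sum>u<m. (f u)\<^sup>2)"
proof -
  have "(\<Sum>v<n. of_bool (u < m \<and> v < m \<and> u \<noteq> v) * (f u * f v)) =
      of_bool (u < m) * (f u * (\<Sum>v<m. f v) - (f u)\<^sup>2)" for u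
  proof (cases "u < m")
    case True
    have "(\<Sum>v<n. of_bool (u < m \<and> v < m \<and> u \<noteq> v) * (f u * f v)) = (\<Sum>v\<in>{..<m} - {u}. f u * f v)"
      using assms True by (intro sum.mono_neutral_cong_right) auto
    also have "\<dots> = (\<Sum>v<m. f u * f v) - f u * f u"
      using True by (subst sum_diff1) auto
    finally show ?thesis
      using True by (simp add: sum_distrib_left power2_eq_square)
  qed simp
  hence "(\<Sum>u<n. \<Sum>v<n. of_bool (u < m \<and> v < m \<and> u \<noteq> v) * (f u * f v)) =
      (\<Sum>u<n. of_bool (u < m) * (f u * (\<Sum>v<m. f v) - (f u)\<^sup>2))"
    by simp
  also have "\<dots> = (\<Sum>u<m. f u * (\<Sum>v<m. f v) - (f u)\<^sup>2)"
    using assms by (intro sum.mono_neutral_cong_right) auto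
  finally show ?thesis
    by (simp add: sum_subtractf sum_distrib_right[symmetric] power2_eq_square)
qed

lemma energy_necklace:
  "energy (necklace T k) f =
    (\<Sum>u<k * block_length T. \<Sum>v<k * block_length T. of_bool (necklace_adj T u v) * (f u * f v))"
  unfolding energy_def by (simp add: adj_matrix_necklace)

lemma energy_necklace_split:
  assumes "T \<ge> 1" and "k \<ge> 1"
  shows "energy (necklace T k) f = (\<Sum>u<6. f u)\<^sup>2 - (\<Sum>u<6. (f u)\<^sup>2) +
    (\<Sum>u<k * block_length T. \<Sum>v<k * block_length T. of_bool (link T u v) * (f u * f v))"
proof -
  have n: "6 \<le> k * block_length T" by (rule necklace_size[OF assms])
  \<comment> \<open>The first path edge, from 5 to 6, already leaves the clique, and chords start at
    \<open>block_length T \<ge> 6\<close> or later.\<close>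
  have disj: "\<not> (u < 6 \<and> v < 6 \<and> u \<noteq> v \<and> link T u v)" for u v
    using assms(1) by (auto simp: link_def step_def)
  have split: "of_bool (necklace_adj T u v) =
      of_bool (u < 6 \<and> v < 6 \<and> u \<noteq> v) + (of_bool (link T u v) :: real)" for u v
    using disj[of u v] unfolding necklace_adj_def of_bool_def by auto
  show ?thesis
    unfolding energy_necklace split distrib_right sum.distrib clique_form[OF n] ..
qed

text \<open>The indicator of the clique has Rayleigh quotient at least 5, because the remaining
  edges contribute nonnegatively.\<close>

lemma eig_1_necklace:
  assumes "T \<ge> 1" and "k \<ge> 1"
  shows "5 \<le> eig (necklace T k) 1"
proof -
  let ?n = "k * block_length T"
  have n: "6 \<le> ?n" by (rule necklace_size[OF assms])
  show ?thesis
  proof (rule eig_ge_of_test_vectors[OF standard_necklace, where f = "\<lambda>_ x. of_bool (x < 6)"])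
    fix c :: "nat \<Rightarrow> real"
    show "\<exists>x<order_graph (necklace T k). (\<Sum>i<1. c i * of_bool (x < 6)) \<noteq> 0" if "i < 1" "c i \<noteq> 0" for i
      using that assms by (intro exI[of _ 0]) auto
    let ?f = "\<lambda>x. c 0 * of_bool (x < 6)"
    have "(\<Sum>x<?n. (?f x)\<^sup>2) = (\<Sum>x<6::nat. (c 0)\<^sup>2)"
      using n by (intro sum.mono_neutral_cong_right) auto
    hence "5 * (\<Sum>x<?n. (?f x)\<^sup>2) = (\<Sum>u<6::nat. ?f u)\<^sup>2 - (\<Sum>u<6::nat. (?f u)\<^sup>2)"
      by (simp add: power_mult_distrib)
    also have "\<dots> \<le> energy (necklace T k) ?f"
      unfolding energy_necklace_split[OF assms] by (auto intro!: sum_nonneg)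
    finally show "5 * (\<Sum>x<order_graph (necklace T k). (\<Sum>i<1. c i * of_bool (x < 6))\<^sup>2)
        \<le> energy (necklace T k) (\<lambda>x. \<Sum>i<1. c i * of_bool (x < 6))"
      by simp
  qed (use n assms in auto)
qed

context tribonacci_root begin

text \<open>On vectors with sum zero over the clique only the \<open>link\<close> form can be
  positive. The periodic even profile is a positive supersolution for it.\<close>

lemma eig_2_necklace:
  assumes T: "T \<ge> 1" and k: "k \<ge> 1"
  shows "eig (necklace T k) 2 \<le> \<theta> + \<epsilon> T"
proof -
  let ?L = "block_length T"
  let ?n = "k * ?L"
  have n: "6 \<le> ?n" by (rule necklace_size[OF T k])
  define y where "y u = block_profile r T 1 (u mod ?L)" for u
  have y: "0 < y u" for u by (simp add: y_def block_profile_pos)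
  have super: "(\<Sum>v<?n. of_bool (link T u v) * y v) \<le> (\<theta> + \<epsilon> T) * y u" for u
  proof -
    let ?s = "u mod ?L"
    have s: "?s < ?L" by simp
    have "of_bool (1 \<le> u) * y (u - 1) \<le> block_profile r T 1 (if ?s = 0 then ?L - 1 else ?s - 1)"
    proof (cases "1 \<le> u")
      case True
      thus ?thesis using mod_neighbours(2)[of ?L u] by (simp add: y_def)
    qed (simp add: block_profile_pos less_imp_le)
    moreover have "y (u + 1) = block_profile r T 1 (if ?s + 1 = ?L then 0 else ?s + 1)"
      unfolding y_def by (subst mod_neighbours(1)) auto
    moreover have "of_bool (?s = T) * y (u + 2) = of_bool (?s = T) * block_profile r T 1 (T + 2)"
      using chord_residue(1)[of u T] by (cases "?s = T") (simp_all add: y_def)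
    moreover have "of_bool (?s = T + 2) * y (u - 2) = of_bool (?s = T + 2) * block_profile r T 1 T"
      using chord_residue'(2)[of u T] by (cases "?s = T + 2") (simp_all add: y_def)
    ultimately have "(\<Sum>v<?n. of_bool (link T u v) * y v) \<le>
        \<theta> * y u + of_bool (?s = T \<or> ?s = T + 2) * (1 * (r - 1 / r))"
      using link_neighbour_sum_le[of y T u ?n, OF less_imp_le[OF y]]
        block_profile_neighbours[OF s T disjI2[OF refl]]
      unfolding y_def[of u] by (smt (verit))
    \<comment> \<open>The residual occurs only at base vertices, where \<open>y\<close> is
      exponentially large in \<open>T\<close>.\<close>
    also have "of_bool (?s = T \<or> ?s = T + 2) * (1 * (r - 1 / r)) \<le> \<epsilon> T * y u"
    proof (cases "?s = T \<or> ?s = T + 2")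
      case True
      hence "y u = path_profile r T 1 0" by (auto simp: y_def block_profile_def)
      thus ?thesis using True cosh_excess[of T] by simp
    next
      case False
      have "0 \<le> \<epsilon> T" using pos by (simp add: \<epsilon>_def)
      with False y[of u] show ?thesis by simp
    qed
    finally show ?thesis by (simp add: distrib_right)
  qed
  show ?thesis
  proof (rule eig_2_le_of_hyperplane[OF standard_necklace, where w = "\<lambda>x. of_bool (x < 6)"])
    fix f :: "nat \<Rightarrow> real"
    assume "(\<Sum>x<order_graph (necklace T k). of_bool (x < 6) * f x) = 0"
    moreover have "(\<Sum>x<?n. of_bool (x < 6) * f x) = (\<Sum>x<6. f x)"
      using n by (intro sum.mono_neutral_cong_right) auto
    ultimately have "(\<Sum>x<6. f x) = 0" by simp
    moreover have "0 \<le> (\<Sum>u<6. (f u)\<^sup>2)" by (intro sum_nonneg) simp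
    ultimately have "energy (necklace T k) f \<le> (\<Sum>u<?n. \<Sum>v<?n. of_bool (link T u v) * (f u * f v))"
      unfolding energy_necklace_split[OF T k] by simp
    also have "\<dots> \<le> (\<theta> + \<epsilon> T) * (\<Sum>u<?n. (f u)\<^sup>2)"
      by (rule quadratic_form_le_of_supersolution[OF link_sym y super])
    finally show "energy (necklace T k) f \<le> (\<theta> + \<epsilon> T) * (\<Sum>x<order_graph (necklace T k). (f x)\<^sup>2)"
      by simp
  qed (use n in simp)
qed

text \<open>The test vectors are copies of the odd profile on blocks 1 to \<open>j\<close>, avoiding
  the block of the clique. The profile vanishes at the last position of a block, so no edge joins
  the supports of different copies.\<close>

lemma eig_necklace_ge:
  assumes T: "T \<ge> 1" and j: "1 \<le> j" "j + 1 \<le> k"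
  shows "\<theta> - \<epsilon> T \<le> eig (necklace T k) j"
proof -
  let ?L = "block_length T"
  let ?n = "k * ?L"
  define p where "p = block_profile r T (-1)"
  define f where "f i x = (if x div ?L = i + 1 then p (x mod ?L) else 0)" for i x
  have triangle: "p T = path_profile r T (-1) 0" "p (T + 2) = path_profile r T (-1) 0"
    by (simp_all add: p_def block_profile_def)
  show ?thesis
  proof (rule eig_ge_of_test_vectors[OF standard_necklace, where f = f])
    show "1 \<le> j" by fact
    have "k * 1 \<le> ?n" by (intro mult_le_mono) auto
    moreover have "order_graph (necklace T k) = ?n" by simp
    ultimately show "j \<le> order_graph (necklace T k)" using j by linarith
  next
    fix c :: "nat \<Rightarrow> real"
    define g where "g x = (\<Sum>i<j. c i * f i x)" for x
    \<comment> \<open>The coefficient carried by block \<open>q\<close>, with value 0 on blocks that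
      have no test vector.\<close>
    define C where "C q = (if 1 \<le> q \<and> q \<le> j then c (q - 1) else 0)" for q
    have g: "g x = C (x div ?L) * p (x mod ?L)" for x
    proof -
      have "g x = (\<Sum>i<j. if i + 1 = x div ?L then c i * p (x mod ?L) else 0)"
        unfolding g_def f_def by (intro sum.cong) auto
      also have "\<dots> = (\<Sum>i<j. if i = x div ?L - 1 then C (x div ?L) * p (x mod ?L) else 0)"
        by (intro sum.cong) (auto simp: C_def)
      also have "\<dots> = C (x div ?L) * p (x mod ?L)"
        by (auto simp: C_def)
      finally show ?thesis .
    qed
    show "\<exists>x<order_graph (necklace T k). (\<Sum>i<j. c i * f i x) \<noteq> 0" if "i < j" "c i \<noteq> 0" for i
    proof (intro exI conjI)
      let ?x = "T + ?L * (i + 1)"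
      have m: "?x mod ?L = T" by (subst mod_mult_self2) simp
      have d: "?x div ?L = i + 1" by (subst div_mult_self2) simp_all
      have "?x < ?L * (i + 2)" by simp
      also have "\<dots> \<le> ?L * k" using that j by (intro mult_left_mono) auto
      finally show "?x < order_graph (necklace T k)" by (simp add: mult.commute)
      have "g ?x = c i * path_profile r T (-1) 0"
        unfolding g m d triangle using that by (simp add: C_def)
      thus "(\<Sum>i<j. c i * f i ?x) \<noteq> 0"
        using that sinh_deficit(2)[of T] by (simp add: g_def)
    qed
    \<comment> \<open>The energy bound already holds vertex by vertex. Where \<open>g u\<close> is
      nonzero, all neighbours lie in the block of \<open>u\<close>, except \<open>u - 1\<close> when
      \<open>u\<close> is the first vertex of its block.\<close>
    have local: "(\<theta> - \<epsilon> T) * (g u)\<^sup>2 \<le> g u * (\<Sum>v<?n. of_bool (necklace_adj T u v) * g v)" if u: "u < ?n" for u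
    proof (cases "g u = 0")
      case False
      let ?s = "u mod ?L" and ?q = "u div ?L"
      have q: "1 \<le> ?q" using False by (auto simp: g C_def split: if_splits)
      have s: "?s < ?L" by simp
      have "?s \<noteq> 2 * T + 3"
        using False block_profile_sinh_end[of T] by (auto simp: g p_def)
      with s have s': "?s + 1 < ?L" by linarith
      have uL: "?L \<le> u"
        using q by (metis div_less le_zero_eq not_less zero_neq_one)
      have u_eq: "u = ?L * ?q + ?s" by simp
      have "?q < k" using u by (simp add: less_mult_imp_div_less)
      hence "?L * (?q + 1) \<le> ?L * k" by (intro mult_left_mono) auto
      hence qn: "?L * ?q + ?L \<le> ?n" by (simp add: mult.commute)
      have "u + 1 < ?n" using u_eq qn s' by linarith
      moreover have "u + 2 < ?n" if "?s = T" using u_eq qn that by linarith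
      ultimately have "(\<Sum>v<?n. of_bool (necklace_adj T u v) * g v) =
          g (u - 1) + g (u + 1) + of_bool (?s = T) * g (u + 2) + of_bool (?s = T + 2) * g (u - 2)"
        by (intro necklace_neighbour_sum T uL)
      also have "g (u - 1) = C ?q * p (if ?s = 0 then ?L - 1 else ?s - 1)"
      \<comment> \<open>At the start of a block the left neighbour is the end of the previous one,
        where the odd profile is 0 whatever the coefficient there.\<close>
      proof (cases "?s = 0")
        case True
        have "(u - 1) mod ?L = ?L - 1"
          using mod_neighbours(2)[of ?L u] uL True by simp
        moreover have "p (?L - 1) = 0"
          using block_profile_sinh_end[of T] by (simp add: p_def numeral_3_eq_3)
        ultimately show ?thesis using True by (simp add: g)
      next
        case False
        thus ?thesis
          using mod_neighbours(2)[of ?L u] div_neighbours(2)[OF s'] uL by (simp add: g)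
      qed
      also have "g (u + 1) = C ?q * p (if ?s + 1 = ?L then 0 else ?s + 1)"
        unfolding g using mod_neighbours(1)[of ?L u] div_neighbours(1)[OF s'] by simp
      also have "of_bool (?s = T) * g (u + 2) = C ?q * (of_bool (?s = T) * p (T + 2))"
        using chord_residue[of u T] by (cases "?s = T") (simp_all add: g)
      also have "of_bool (?s = T + 2) * g (u - 2) = C ?q * (of_bool (?s = T + 2) * p T)"
        using chord_residue'[of u T] by (cases "?s = T + 2") (simp_all add: g)
      finally have "(\<Sum>v<?n. of_bool (necklace_adj T u v) * g v) =
          C ?q * (p (if ?s = 0 then ?L - 1 else ?s - 1) + p (if ?s + 1 = ?L then 0 else ?s + 1) +
            of_bool (?s = T) * p (T + 2) + of_bool (?s = T + 2) * p T)"
        by (simp only: distrib_left)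
      also have "\<dots> = C ?q * (\<theta> * p ?s - of_bool (?s = T \<or> ?s = T + 2) * (r - 1 / r))"
        unfolding p_def using s' by (subst block_profile_neighbours[OF s T]) auto
      finally have "g u * (\<Sum>v<?n. of_bool (necklace_adj T u v) * g v) =
          (C ?q)\<^sup>2 * (p ?s * (\<theta> * p ?s - of_bool (?s = T \<or> ?s = T + 2) * (r - 1 / r)))"
        by (simp add: g power2_eq_square mult_ac)
      also have "\<dots> \<ge> (C ?q)\<^sup>2 * ((\<theta> - \<epsilon> T) * (p ?s)\<^sup>2)"
      proof (intro mult_left_mono)
        have \<epsilon>: "0 \<le> \<epsilon> T" using pos by (simp add: \<epsilon>_def)
        show "(\<theta> - \<epsilon> T) * (p ?s)\<^sup>2 \<le> p ?s * (\<theta> * p ?s - of_bool (?s = T \<or> ?s = T + 2) * (r - 1 / r))"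
        proof (cases "?s = T \<or> ?s = T + 2")
          case True
          hence ps: "p ?s = path_profile r T (-1) 0" using triangle by metis
          have "p ?s * (r - 1 / r) \<le> p ?s * (\<epsilon> T * p ?s)"
            unfolding ps using sinh_deficit by (intro mult_left_mono) (auto intro: less_imp_le)
          thus ?thesis using True by (simp add: algebra_simps power2_eq_square)
        next
          case False
          thus ?thesis using \<epsilon> by (simp add: algebra_simps power2_eq_square)
        qed
      qed simp
      finally show ?thesis
        by (simp add: g power_mult_distrib mult_ac)
    qed simp
    have "(\<theta> - \<epsilon> T) * (\<Sum>u<?n. (g u)\<^sup>2) \<le> (\<Sum>u<?n. g u * (\<Sum>v<?n. of_bool (necklace_adj T u v) * g v))"
      unfolding sum_distrib_left[of "\<theta> - \<epsilon> T"] using local by (intro sum_mono) auto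
    also have "\<dots> = energy (necklace T k) g"
      unfolding energy_necklace sum_distrib_left by (intro sum.cong refl) (simp only: mult_ac)
    finally show "(\<theta> - \<epsilon> T) * (\<Sum>x<order_graph (necklace T k). (\<Sum>i<j. c i * f i x)\<^sup>2)
        \<le> energy (necklace T k) (\<lambda>x. \<Sum>i<j. c i * f i x)"
      unfolding g_def[symmetric] by simp
  qed
qed

end

section \<open>Choice of the parameters and conclusion\<close>

lemma tribonacci_root_exists: "\<exists>r. tribonacci_root r"
proof -
  let ?f = "\<lambda>x::real. x ^ 3 - x\<^sup>2 - x - 1"
  have "\<exists>x\<ge>9/5. x \<le> 2 \<and> ?f x = 0"
    by (rule IVT') (auto simp: power2_eq_square power3_eq_cube intro!: continuous_intros)
  then obtain r where "9 / 5 \<le> r" "r \<le> 2" "?f r = 0" by auto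
  thus ?thesis by (intro exI[of _ r]) (simp add: tribonacci_root_def)
qed

text \<open>Base 3 is what matters: the logarithm of the order grows like \<open>2 ^ T\<close>, so
  its product with this bound tends to 0.\<close>

lemma (in tribonacci_root) \<epsilon>_le: "\<epsilon> T \<le> 1 / 3 ^ T"
proof -
  have "9 / 5 * (9 / 5) \<le> r * r" using lower by (intro mult_mono) auto
  hence "3 \<le> r\<^sup>2" by (simp add: power2_eq_square)
  hence "3 ^ (T + 1) \<le> (r\<^sup>2) ^ (T + 1)" by (intro power_mono) auto
  also have "\<dots> = r ^ (2 * T + 2)" by (simp add: power_mult power2_eq_square)
  finally have "3 / r ^ (2 * T + 2) \<le> 3 / 3 ^ (T + 1)"
    using pos by (intro divide_left_mono) auto
  thus ?thesis by (simp add: \<epsilon>_def)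
qed

text \<open>Here \<open>l\<close> is the logarithm of the order. Hypothesis \<open>gap\<close>
  reduces the gap claim to a gap of at least 1, and \<open>window\<close> makes the spread
  \<open>2 * \<epsilon> T\<close> of the triangle eigenvalues at most
  \<open>\<delta> / l\<close>.\<close>

lemma necklace_spectrum:
  fixes C \<delta> :: real and T :: nat
  assumes C: "C > 0" and \<delta>: "\<delta> > 0" and T: "T \<ge> 2"
  defines "l \<equiv> 2 ^ T * ln 2 + ln (2 * real T + 4)"
  assumes gap: "C \<le> l" and window: "2 * l / 3 ^ T \<le> \<delta>"
  defines "G \<equiv> necklace T (2 ^ 2 ^ T)"
  shows "standard_graph G" "Digraph_Component.connected (with_proj G)" "max_degree G = 6"
    "C / ln (order_graph G) \<le> spectral_gap G"
    "1 / 100 * order_graph G / ln (ln (order_graph G)) \<le>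
      eig_count G ((1 - \<delta> / ln (order_graph G)) * eig G 2) (eig G 2)"
proof -
  obtain r where "tribonacci_root r" using tribonacci_root_exists ..
  then interpret tribonacci_root r .
  define k :: nat where "k = 2 ^ 2 ^ T"
  have G_eq: "G = necklace T k" by (simp add: G_def k_def)
  have "(2::nat) ^ 2 ^ 1 \<le> 2 ^ 2 ^ T"
    using T by (intro power_increasing) auto
  hence k: "4 \<le> k" by (simp add: k_def)
  define n where "n = order_graph G"
  have n: "n = k * block_length T" by (simp add: n_def G_eq)
  have "real n = 2 ^ 2 ^ T * (2 * real T + 4)" by (simp add: n k_def)
  hence l: "ln n = l" by (simp add: l_def ln_mult ln_realpow)
  have l_pos: "l > 0" using gap C by simp
  have "1 / 3 ^ T \<le> (1 / 3 ^ 1 :: real)"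
    using T by (intro divide_left_mono power_increasing) auto
  from order_trans[OF \<epsilon>_le this] have \<epsilon>1: "\<epsilon> T \<le> 1 / 3" by simp
  have "2 * \<epsilon> T * l \<le> 2 * (1 / 3 ^ T) * l"
    using \<epsilon>_le[of T] l_pos by (intro mult_right_mono mult_left_mono) auto
  also have "\<dots> \<le> \<delta>" using window by simp
  finally have \<epsilon>2: "2 * \<epsilon> T \<le> \<delta> / l" using l_pos by (simp add: field_simps)
  show G: "standard_graph G" by (simp add: G_eq standard_necklace)
  show "Digraph_Component.connected (with_proj G)"
    unfolding G_eq using k by (intro connected_necklace) simp
  show "max_degree G = 6"
    unfolding G_eq using k T by (intro max_degree_necklace) auto
  have T1: "1 \<le> T" and k1: "1 \<le> k" using T k by auto
  have e1: "5 \<le> eig G 1" unfolding G_eq by (rule eig_1_necklace[OF T1 k1])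
  have e2: "eig G 2 \<le> \<theta> + \<epsilon> T" unfolding G_eq by (rule eig_2_necklace[OF T1 k1])
  have ej: "\<theta> - \<epsilon> T \<le> eig G j" if "1 \<le> j" "j \<le> k - 1" for j
    unfolding G_eq using T that k by (intro eig_necklace_ge) auto
  have "C / l \<le> 1" using gap l_pos by simp
  also have "1 \<le> spectral_gap G"
    using e1 e2 \<epsilon>1 theta_bounds by (simp add: spectral_gap_def)
  finally show "C / ln (order_graph G) \<le> spectral_gap G"
    using l by (simp add: n_def)
  \<comment> \<open>A second eigenvalue of at least 1 turns the additive spread into a relative
    one.\<close>
  have "\<theta> - \<epsilon> T \<le> eig G 2" using k by (intro ej) auto
  hence "1 \<le> eig G 2" using theta_bounds \<epsilon>1 by simp
  hence "\<delta> / l * 1 \<le> \<delta> / l * eig G 2"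
    using \<delta> l_pos by (intro mult_left_mono) auto
  hence low: "(1 - \<delta> / l) * eig G 2 \<le> \<theta> - \<epsilon> T"
    using e2 \<epsilon>2 by (simp add: left_diff_distrib)
  have "k * 1 \<le> n" unfolding n by (intro mult_le_mono) auto
  hence kn: "k - 1 \<le> n" by simp
  \<comment> \<open>Index 1 is left out because it belongs to the outlier of the clique;
    \<open>k - 1\<close> is the number of triangles.\<close>
  have "{2..k - 1} \<subseteq> {j \<in> {1..n}. eig G j \<in> {(1 - \<delta> / l) * eig G 2..eig G 2}}"
  proof
    fix j assume j: "j \<in> {2..k - 1}"
    hence "eig G j \<le> eig G 2"
      using kn by (intro eig_antimono[OF G]) (auto simp: n_def)
    moreover have "(1 - \<delta> / l) * eig G 2 \<le> eig G j"
      using ej[of j] low j by auto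
    ultimately show "j \<in> {j \<in> {1..n}. eig G j \<in> {(1 - \<delta> / l) * eig G 2..eig G 2}}"
      using j kn by auto
  qed
  hence "card {2..k - 1} \<le> eig_count G ((1 - \<delta> / l) * eig G 2) (eig G 2)"
    unfolding eig_count_def n_def by (intro card_mono) auto
  moreover have "real k / 2 \<le> real (card {2..k - 1})"
    using k by (simp add: of_nat_diff)
  ultimately have count: "real k / 2 \<le> eig_count G ((1 - \<delta> / l) * eig G 2) (eig G 2)"
    by linarith
  \<comment> \<open>It remains to bound the block length by a multiple of \<open>ln l\<close>. The
    constant 50 is generous: \<open>S \<ge> 1\<close> makes \<open>(2 * S + 6) / 50\<close> at most
    \<open>S / 2\<close>.\<close>
  obtain S where S: "T = S + 1" "1 \<le> S"
    using T by (intro that[of "T - 1"]) auto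
  have ln2: "1 / 2 \<le> ln (2 :: real)" by (subst ln_ge_iff) (simp_all only: exp_half_le2 zero_less_numeral)
  have "2 ^ S = 2 ^ T * (1 / 2 :: real)" by (simp add: S)
  also have "\<dots> \<le> 2 ^ T * ln 2"
    using ln2 by (intro mult_left_mono) auto
  also have "\<dots> \<le> l" by (simp add: l_def)
  finally have "2 ^ S \<le> l" .
  have "(2 * real T + 4) / 50 \<le> real S * (1 / 2)" using S by simp
  also have "\<dots> \<le> real S * ln 2" using ln2 by (intro mult_left_mono) auto
  also have "\<dots> = ln (2 ^ S)" by (simp add: ln_realpow)
  also have "\<dots> \<le> ln l" using \<open>2 ^ S \<le> l\<close> by (intro ln_mono) auto
  finally have len: "(2 * real T + 4) / 50 \<le> ln l" .
  have "0 < (2 * real T + 4) / 50" by simp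
  with len have "0 < ln l" by linarith
  \<comment> \<open>The final constant 1/100 combines 1/2 from the count and 1/50 from the block
    length.\<close>
  have "1 / 100 * real n = real k / 2 * ((2 * real T + 4) / 50)"
    by (simp add: n)
  also have "\<dots> \<le> real k / 2 * ln l"
    by (intro mult_left_mono len) simp
  finally have "1 / 100 * real n / ln l \<le> real k / 2"
    using \<open>0 < ln l\<close> by (simp add: pos_divide_le_eq)
  with count show "1 / 100 * order_graph G / ln (ln (order_graph G)) \<le>
      eig_count G ((1 - \<delta> / ln (order_graph G)) * eig G 2) (eig G 2)"
    unfolding n_def[symmetric] l by linarith
qed

text \<open>The constant 1/100 works for all \<open>C\<close> and \<delta>; these only determine how
  large \<open>T\<close> must be.\<close>

theorem theorem1p7:
  fixes C \<delta> :: real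
  assumes "C > 0" and "\<delta> > 0"
  shows "\<exists>c::real. c > 0 \<and>
    infinite {G :: nat pair_pre_digraph.
      standard_graph G \<and> Digraph_Component.connected (with_proj G) \<and> max_degree G = 6 \<and>
      (let n = real (order_graph G) in
        spectral_gap G \<ge> C / ln n \<and>
        real (eig_count G ((1 - \<delta> / ln n) * eig G 2) (eig G 2)) \<ge> c * n / ln (ln n))}"
proof (intro exI[of _ "1 / 100"] conjI)
  let ?l = "\<lambda>T::nat. 2 ^ T * ln 2 + ln (2 * real T + 4)"
  let ?S = "{G :: nat pair_pre_digraph.
      standard_graph G \<and> Digraph_Component.connected (with_proj G) \<and> max_degree G = 6 \<and>
      (let n = real (order_graph G) in
        spectral_gap G \<ge> C / ln n \<and>
        real (eig_count G ((1 - \<delta> / ln n) * eig G 2) (eig G 2)) \<ge> 1 / 100 * n / ln (ln n))}"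
  have "filterlim ?l at_top sequentially"
    by real_asymp
  hence "\<forall>\<^sub>F T in sequentially. C \<le> ?l T"
    by (simp add: filterlim_at_top)
  moreover have "(\<lambda>T. 2 * ?l T / 3 ^ T) \<longlonglongrightarrow> 0"
    by real_asymp
  hence "\<forall>\<^sub>F T in sequentially. 2 * ?l T / 3 ^ T < \<delta>"
    using assms(2) by (rule order_tendstoD)
  ultimately have "\<forall>\<^sub>F T in sequentially. 2 \<le> T \<and> C \<le> ?l T \<and> 2 * ?l T / 3 ^ T < \<delta>"
    using eventually_ge_at_top[of 2] by eventually_elim simp
  then obtain T\<^sub>0 where T\<^sub>0: "\<And>T. T \<ge> T\<^sub>0 \<Longrightarrow> 2 \<le> T \<and> C \<le> ?l T \<and> 2 * ?l T / 3 ^ T < \<delta>"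
    unfolding eventually_sequentially by blast
  let ?G = "\<lambda>T. necklace T (2 ^ 2 ^ T)"
  have "?G ` {T\<^sub>0..} \<subseteq> ?S"
  proof
    fix G assume "G \<in> ?G ` {T\<^sub>0..}"
    then obtain T where T: "T \<ge> T\<^sub>0" and G: "G = ?G T" by auto
    note T' = T\<^sub>0[OF T]
    show "G \<in> ?S"
      using necklace_spectrum[of C \<delta> T] T' assms by (simp add: Let_def G less_imp_le)
  qed
  moreover have "infinite (?G ` {T\<^sub>0..})"
  proof -
    \<comment> \<open>Distinct orders make the graphs pairwise non-isomorphic, in particular
      distinct.\<close>
    have "strict_mono (\<lambda>T. order_graph (?G T))"
    proof (rule strict_monoI)
      fix T T' :: nat assume "T < T'"
      hence "(2::nat) ^ 2 ^ T * block_length T < 2 ^ 2 ^ T' * block_length T'"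
        by (intro mult_strict_mono power_strict_increasing) auto
      thus "order_graph (?G T) < order_graph (?G T')" by simp
    qed
    hence order_inj: "inj (\<lambda>T. order_graph (?G T))" by (rule strict_mono_imp_inj_on)
    have "inj_on ?G {T\<^sub>0..}"
    proof (rule inj_onI)
      fix T T' assume "?G T = ?G T'"
      hence "order_graph (?G T) = order_graph (?G T')" by (rule arg_cong)
      thus "T = T'" by (rule injD[OF order_inj])
    qed
    thus ?thesis
      using finite_imageD infinite_Ici by blast
  qed
  ultimately show "infinite ?S" by (rule infinite_super)
qed simp

end
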